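(* Each trivial noncommutative principal $\mathbb{T}^n$-bundle $(A,\mathbb{T}^n,\alpha)$ carries the structure of a noncommutative principal $\mathbb{T}^n$-bundle (that is, $(A,\mathbb{T}^n,\alpha)$ is a noncommutative principal $\mathbb{T}^n$-bundle in its own right).
   Context: All algebras are complex and associative. A locally convex algebra is a (Hausdorff) locally convex space with a jointly continuous bilinear associative multiplication. $\operatorname{Aut}(A)$ is the group of automorphisms of $A$ as a (unital) locally convex algebra. For an algebra $A$, $\Gamma_A$ is the set of nonzero algebra homomorphisms $A\to\mathbb{C}$ (characters) with the topology of pointwise convergence. A dynamical system $(A,G,\alpha)$ consists of a unital locally convex algebra $A$, a topological group $G$ and a homomorphism $\alpha:G\to\operatorname{Aut}(A)$ such that $G\times A\to A$, $(g,a)\mapsto\alpha(g)a$, is continuous. For a manifold $M$ and a locally convex space $E$, $C^\infty(M,E)$ carries the smooth compact open topology: the initial topology for the maps $f\mapsto T^kf\in C(T^kM,T^kE)$, $k\in\mathbb{N}_0$ ($T^k$ the iterated tangent functor), where $C(T^kM,T^kE)$ has the compact open topology. Trivial bundles: a dynamical system $(A,\mathbb{T}^n,\alpha)$ is a trivial noncommutative principal $\mathbb{T}^n$-bundle if for each ${\bf k}\in\mathbb{Z}^n$ the isotypic component $A_{\bf k}:=\{a\in A:\alpha(t)a=t^{\bf k}a\ \forall t\in\mathbb{T}^n\}$ contains an invertible element of $A$. Localization: for a dynamical system $(A,G,\alpha)$ let $Z:=C_A^G$ be the fixed point algebra of the $G$-action on the center $C_A$ of $A$. For $z\in Z$ let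 $A_{\{z\}}:=C^\infty(\mathbb{R},A)/I_z$, where $I_z$ is the closure of the two-sided ideal generated by $t\mapsto 1_A-tz$. Then $\alpha_{\{z\}}(g)[f]:=[\alpha(g)\circ f]$ makes $(A_{\{z\}},G,\alpha_{\{z\}})$ a dynamical system. A dynamical system $(A,\mathbb{T}^n,\alpha)$ is a noncommutative principal $\mathbb{T}^n$-bundle if for each $\chi\in\Gamma_Z$ there is an element $z\in Z$ with $\chi(z)\neq0$ such that $(A_{\{z\}},\mathbb{T}^n,\alpha_{\{z\}})$ is a trivial noncommutative principal $\mathbb{T}^n$-bundle. *)

theory Defs
  imports
    "HOL-Analysis.Analysis"
    "HOL-Algebra.Module"
    "HOL-Algebra.QuotRing"
    "HOL-Algebra.Bij"
    "HOL-Algebra.Product_Groups"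
    "HOL-Algebra.Algebraic_Closure_Type"
begin

section \<open>Unital locally convex algebras\<close>

text \<open>
  Algebras live on carrier sets, because the localizations below are quotients that depend on an
  element of the given algebra.
\<close>

record 'a top_algebra = "(complex, 'a) module" +
  topol :: "'a topology"

abbreviation complex_ring :: "complex ring"
  where "complex_ring \<equiv> ring_of_type_algebra"

text \<open>
  The library locale \<open>algebra\<close> only covers commutative algebras, hence the combination of
  \<open>ring\<close> and \<open>module\<close>. The zero algebra is not excluded.
\<close>

locale lc_algebra =
  ring A + module complex_ring A for A :: "'a top_algebra" (structure) +
  assumes smult_mult_left:
      "\<And>c x y. \<lbrakk>x \<in> carrier A; y \<in> carrier A\<rbrakk> \<Longrightarrow> (c \<odot> x) \<otimes> y = c \<odot> (x \<otimes> y)"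
    and smult_mult_right:
      "\<And>c x y. \<lbrakk>x \<in> carrier A; y \<in> carrier A\<rbrakk> \<Longrightarrow> x \<otimes> (c \<odot> y) = c \<odot> (x \<otimes> y)"
    and topspace_topol: "topspace (topol A) = carrier A"
    and Hausdorff: "Hausdorff_space (topol A)"
    and continuous_add:
      "continuous_map (prod_topology (topol A) (topol A)) (topol A) (\<lambda>(x, y). x \<oplus> y)"
    and continuous_smult:
      "continuous_map (prod_topology euclidean (topol A)) (topol A) (\<lambda>(c, x). c \<odot> x)"
    and continuous_mult:
      "continuous_map (prod_topology (topol A) (topol A)) (topol A) (\<lambda>(x, y). x \<otimes> y)"
    and locally_convex:
      "\<And>U. \<lbrakk>openin (topol A) U; \<zero> \<in> U\<rbrakk> \<Longrightarrow>
        \<exists>V. openin (topol A) V \<and> \<zero> \<in> V \<and> V \<subseteq> U \<and>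
          (\<forall>x\<in>V. \<forall>y\<in>V. \<forall>s::real. 0 \<le> s \<and> s \<le> 1 \<longrightarrow>
            complex_of_real s \<odot> x \<oplus> complex_of_real (1 - s) \<odot> y \<in> V)"

text \<open>Characters are not required to be continuous.\<close>

definition characters :: "'a top_algebra \<Rightarrow> ('a \<Rightarrow> complex) set"
  where "characters A =
    {\<xi> \<in> extensional (carrier A).
      (\<forall>x\<in>carrier A. \<forall>y\<in>carrier A. \<xi> (x \<oplus>\<^bsub>A\<^esub> y) = \<xi> x + \<xi> y) \<and>
      (\<forall>c. \<forall>x\<in>carrier A. \<xi> (c \<odot>\<^bsub>A\<^esub> x) = c * \<xi> x) \<and>
      (\<forall>x\<in>carrier A. \<forall>y\<in>carrier A. \<xi> (x \<otimes>\<^bsub>A\<^esub> y) = \<xi> x * \<xi> y) \<and>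
      (\<exists>x\<in>carrier A. \<xi> x \<noteq> 0)}"

definition lc_auto :: "'a top_algebra \<Rightarrow> ('a \<Rightarrow> 'a) set"
  where "lc_auto A =
    {\<phi> \<in> extensional (carrier A).
      \<phi> \<in> ring_iso A A \<and>
      (\<forall>c. \<forall>x\<in>carrier A. \<phi> (c \<odot>\<^bsub>A\<^esub> x) = c \<odot>\<^bsub>A\<^esub> \<phi> x) \<and>
      homeomorphic_map (topol A) (topol A) \<phi>}"

definition lc_Aut :: "'a top_algebra \<Rightarrow> ('a \<Rightarrow> 'a) monoid"
  where "lc_Aut A = BijGroup (carrier A) \<lparr>carrier := lc_auto A\<rparr>"


section \<open>Dynamical systems\<close>

locale top_group = group G for G :: "'g monoid" (structure) and TG :: "'g topology" +
  assumes topspace_group: "topspace TG = carrier G"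
    and continuous_group_mult:
      "continuous_map (prod_topology TG TG) TG (\<lambda>(g, h). g \<otimes> h)"
    and continuous_group_inv: "continuous_map TG TG (\<lambda>g. inv g)"

definition dynamical_system ::
  "'a top_algebra \<Rightarrow> 'g monoid \<Rightarrow> 'g topology \<Rightarrow> ('g \<Rightarrow> 'a \<Rightarrow> 'a) \<Rightarrow> bool"
  where "dynamical_system A G TG \<alpha> \<longleftrightarrow>
    lc_algebra A \<and> top_group G TG \<and> \<alpha> \<in> hom G (lc_Aut A) \<and>
    continuous_map (prod_topology TG (topol A)) (topol A) (\<lambda>(g, a). \<alpha> g a)"

text \<open>The fixed point algebra of the action on the center, as a topological subalgebra.\<close>

definition fixed_center ::
  "'a top_algebra \<Rightarrow> 'g monoid \<Rightarrow> ('g \<Rightarrow> 'a \<Rightarrow> 'a) \<Rightarrow> 'a top_algebra"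
  where "fixed_center A G \<alpha> =
    (let Z = {z \<in> carrier A. (\<forall>a\<in>carrier A. z \<otimes>\<^bsub>A\<^esub> a = a \<otimes>\<^bsub>A\<^esub> z) \<and>
                (\<forall>g\<in>carrier G. \<alpha> g z = z)}
     in A \<lparr>carrier := Z, topol := subtopology (topol A) Z\<rparr>)"


section \<open>The algebra of smooth curves\<close>

definition has_lc_deriv :: "'a top_algebra \<Rightarrow> (real \<Rightarrow> 'a) \<Rightarrow> real \<Rightarrow> 'a \<Rightarrow> bool"
  where "has_lc_deriv A c t l \<longleftrightarrow>
    limitin (topol A) (\<lambda>h. complex_of_real (1 / h) \<odot>\<^bsub>A\<^esub> (c (t + h) \<ominus>\<^bsub>A\<^esub> c t)) l (at 0)"

definition lc_deriv :: "'a top_algebra \<Rightarrow> (real \<Rightarrow> 'a) \<Rightarrow> real \<Rightarrow> 'a"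
  where "lc_deriv A c t = (THE l. has_lc_deriv A c t l)"

text \<open>The function \<open>D k\<close> is the \<open>k\<close>-th derivative of \<open>f\<close>.\<close>

definition smooth_curves :: "'a top_algebra \<Rightarrow> (real \<Rightarrow> 'a) set"
  where "smooth_curves A =
    {f. (\<forall>t. f t \<in> carrier A) \<and>
        (\<exists>D. D 0 = f \<and> (\<forall>k t. has_lc_deriv A (D k) t (D (Suc k) t)))}"

text \<open>
  For a topological vector space \<open>E\<close> one has \<open>T\<^sup>0 E = E\<close> and
  \<open>T\<^sup>k\<^sup>+\<^sup>1 E = T\<^sup>k E \<times> T\<^sup>k E\<close> (base point, tangent vector). We encode
  \<open>T\<^sup>k E\<close> as the power of \<open>E\<close> with index set \<open>{..<2 ^ k}\<close>: in a point of
  \<open>T\<^sup>k\<^sup>+\<^sup>1 E\<close> the first \<open>2 ^ k\<close> components are the base point and the last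
  \<open>2 ^ k\<close> components the tangent vector.
\<close>

definition tangent_topology :: "'e topology \<Rightarrow> nat \<Rightarrow> (nat \<Rightarrow> 'e) topology"
  where "tangent_topology B k = product_topology (\<lambda>_. B) {..<2 ^ k}"

text \<open>
  The map \<open>T\<^sup>k f\<close> for a curve \<open>f\<close>, by
  \<open>T F (x, v) = (F x, dF(x)(v))\<close> with \<open>dF(x)(v)\<close> the derivative of
  \<open>s \<mapsto> F (x + s v)\<close> at \<open>0\<close>.
\<close>

primrec tangent_map ::
  "'a top_algebra \<Rightarrow> (real \<Rightarrow> 'a) \<Rightarrow> nat \<Rightarrow> (nat \<Rightarrow> real) \<Rightarrow> (nat \<Rightarrow> 'a)"
  where
    "tangent_map A f 0 =
      (\<lambda>w \<in> topspace (tangent_topology euclideanreal 0). \<lambda>i\<in>{..<1}. f (w 0))"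
  | "tangent_map A f (Suc k) =
      (\<lambda>w \<in> topspace (tangent_topology euclideanreal (Suc k)). \<lambda>i\<in>{..<2 ^ Suc k}.
        if i < 2 ^ k
        then tangent_map A f k (\<lambda>j\<in>{..<2 ^ k}. w j) i
        else lc_deriv A
          (\<lambda>s. tangent_map A f k (\<lambda>j\<in>{..<2 ^ k}. w j + s * w (2 ^ k + j)) (i - 2 ^ k)) 0)"

text \<open>The compact open topology on \<open>C(B, Y)\<close>.\<close>

definition cont_maps :: "'x topology \<Rightarrow> 'y topology \<Rightarrow> ('x \<Rightarrow> 'y) set"
  where "cont_maps B Y = {f \<in> extensional (topspace B). continuous_map B Y f}"

definition compact_open_topology :: "'x topology \<Rightarrow> 'y topology \<Rightarrow> ('x \<Rightarrow> 'y) topology"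
  where "compact_open_topology B Y =
    topology_generated_by
      {{f \<in> cont_maps B Y. f ` K \<subseteq> U} | K U. compactin B K \<and> openin Y U}"

lemma topspace_compact_open_topology:
  "topspace (compact_open_topology B Y) = cont_maps B Y"
  unfolding compact_open_topology_def topology_generated_by_topspace
  by (auto intro!: exI[of _ "{}"])

text \<open>The smooth compact open topology on \<open>C\<^sup>\<infinity>(\<real>, A)\<close>.\<close>

definition smooth_topology :: "'a top_algebra \<Rightarrow> (real \<Rightarrow> 'a) topology"
  where "smooth_topology A =
    topology_generated_by
      {{f \<in> smooth_curves A. tangent_map A f k \<in> W} | k W.
        openin (compact_open_topology (tangent_topology euclideanreal k)
                  (tangent_topology (topol A) k)) W}"

definition smooth_algebra :: "'a top_algebra \<Rightarrow> (real \<Rightarrow> 'a) top_algebra"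
  where "smooth_algebra A =
    \<lparr>carrier = smooth_curves A,
     mult = (\<lambda>f g t. f t \<otimes>\<^bsub>A\<^esub> g t),
     one = (\<lambda>t. \<one>\<^bsub>A\<^esub>),
     zero = (\<lambda>t. \<zero>\<^bsub>A\<^esub>),
     add = (\<lambda>f g t. f t \<oplus>\<^bsub>A\<^esub> g t),
     smult = (\<lambda>c f t. c \<odot>\<^bsub>A\<^esub> f t),
     topol = smooth_topology A\<rparr>"


section \<open>Quotients and localization\<close>

definition quotient_topology :: "'a topology \<Rightarrow> ('a \<Rightarrow> 'b) \<Rightarrow> 'b topology"
  where "quotient_topology B q =
    topology (\<lambda>U. U \<subseteq> q ` topspace B \<and> openin B {x \<in> topspace B. q x \<in> U})"

lemma openin_quotient_topology:
  "openin (quotient_topology B q) U \<longleftrightarrow>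
    U \<subseteq> q ` topspace B \<and> openin B {x \<in> topspace B. q x \<in> U}"
proof -
  have "istopology (\<lambda>U. U \<subseteq> q ` topspace B \<and> openin B {x \<in> topspace B. q x \<in> U})"
    unfolding istopology_def
  proof (intro conjI allI impI)
    fix S T
    assume S: "S \<subseteq> q ` topspace B \<and> openin B {x \<in> topspace B. q x \<in> S}"
      and T: "T \<subseteq> q ` topspace B \<and> openin B {x \<in> topspace B. q x \<in> T}"
    show "S \<inter> T \<subseteq> q ` topspace B" using S by blast
    have eq: "{x \<in> topspace B. q x \<in> S \<inter> T} =
        {x \<in> topspace B. q x \<in> S} \<inter> {x \<in> topspace B. q x \<in> T}" by blast
    show "openin B {x \<in> topspace B. q x \<in> S \<inter> T}"
      unfolding eq using S T by (blast intro: openin_Int)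
  next
    fix \<K>
    assume K: "\<forall>K\<in>\<K>. K \<subseteq> q ` topspace B \<and> openin B {x \<in> topspace B. q x \<in> K}"
    show "\<Union>\<K> \<subseteq> q ` topspace B" using K by blast
    have eq: "{x \<in> topspace B. q x \<in> \<Union>\<K>} =
        \<Union>((\<lambda>K. {x \<in> topspace B. q x \<in> K}) ` \<K>)" by blast
    show "openin B {x \<in> topspace B. q x \<in> \<Union>\<K>}"
      unfolding eq by (rule openin_Union) (use K in blast)
  qed
  then show ?thesis
    by (simp add: quotient_topology_def topology_inverse')
qed

definition quotient_algebra :: "'a top_algebra \<Rightarrow> 'a set \<Rightarrow> 'a set top_algebra"
  where "quotient_algebra A I =
    \<lparr>carrier = carrier (A Quot I),
     mult = mult (A Quot I),
     one = one (A Quot I),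
     zero = zero (A Quot I),
     add = add (A Quot I),
     smult = (\<lambda>c B. \<Union>x\<in>B. I +>\<^bsub>A\<^esub> (c \<odot>\<^bsub>A\<^esub> x)),
     topol = quotient_topology (topol A) (\<lambda>x. I +>\<^bsub>A\<^esub> x)\<rparr>"

text \<open>
  A two-sided ideal of the underlying ring of a unital algebra is automatically a complex
  subspace, so the ring ideal \<open>Idl\<close> is the algebra ideal.
\<close>

definition loc_ideal :: "'a top_algebra \<Rightarrow> 'a \<Rightarrow> (real \<Rightarrow> 'a) set"
  where "loc_ideal A z =
    Abstract_Topology.closure_of (topol (smooth_algebra A))
      (Idl\<^bsub>smooth_algebra A\<^esub> {\<lambda>t. \<one>\<^bsub>A\<^esub> \<ominus>\<^bsub>A\<^esub> complex_of_real t \<odot>\<^bsub>A\<^esub> z})"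

definition localization :: "'a top_algebra \<Rightarrow> 'a \<Rightarrow> (real \<Rightarrow> 'a) set top_algebra"
  where "localization A z = quotient_algebra (smooth_algebra A) (loc_ideal A z)"

text \<open>
  The map \<open>[f] \<mapsto> [\<alpha> g \<circ> f]\<close>. As for \<^const>\<open>rcoset_mult\<close>, the union over all
  representatives avoids a choice: its members all coincide when the map is well defined.
\<close>

definition loc_action ::
  "'a top_algebra \<Rightarrow> ('g \<Rightarrow> 'a \<Rightarrow> 'a) \<Rightarrow> 'a \<Rightarrow> 'g \<Rightarrow> (real \<Rightarrow> 'a) set \<Rightarrow> (real \<Rightarrow> 'a) set"
  where "loc_action A \<alpha> z g =
    (\<lambda>B \<in> carrier (localization A z).
      \<Union>f\<in>B. loc_ideal A z +>\<^bsub>smooth_algebra A\<^esub> (\<alpha> g \<circ> f))"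


section \<open>Noncommutative principal torus bundles\<close>

definition circle_group :: "complex monoid"
  where "circle_group = \<lparr>carrier = sphere 0 1, mult = (*), one = 1\<rparr>"

definition torus :: "nat \<Rightarrow> (nat \<Rightarrow> complex) monoid"
  where "torus n = product_group {..<n} (\<lambda>_. circle_group)"

definition torus_topology :: "nat \<Rightarrow> (nat \<Rightarrow> complex) topology"
  where "torus_topology n = product_topology (\<lambda>_. top_of_set (sphere 0 1)) {..<n}"

text \<open>Only the values of \<open>k\<close> below \<open>n\<close> matter, so \<open>k\<close> represents an element of \<open>\<int>\<^sup>n\<close>.\<close>

definition isotypic_component ::
  "nat \<Rightarrow> 'a top_algebra \<Rightarrow> ((nat \<Rightarrow> complex) \<Rightarrow> 'a \<Rightarrow> 'a) \<Rightarrow> (nat \<Rightarrow> int) \<Rightarrow> 'a set"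
  where "isotypic_component n A \<alpha> k =
    {a \<in> carrier A. \<forall>t\<in>carrier (torus n). \<alpha> t a = (\<Prod>i<n. t i powi k i) \<odot>\<^bsub>A\<^esub> a}"

definition trivial_nc_principal_bundle ::
  "nat \<Rightarrow> 'a top_algebra \<Rightarrow> ((nat \<Rightarrow> complex) \<Rightarrow> 'a \<Rightarrow> 'a) \<Rightarrow> bool"
  where "trivial_nc_principal_bundle n A \<alpha> \<longleftrightarrow>
    dynamical_system A (torus n) (torus_topology n) \<alpha> \<and>
    (\<forall>k. isotypic_component n A \<alpha> k \<inter> Units A \<noteq> {})"

definition nc_principal_bundle ::
  "nat \<Rightarrow> 'a top_algebra \<Rightarrow> ((nat \<Rightarrow> complex) \<Rightarrow> 'a \<Rightarrow> 'a) \<Rightarrow> bool"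
  where "nc_principal_bundle n A \<alpha> \<longleftrightarrow>
    dynamical_system A (torus n) (torus_topology n) \<alpha> \<and>
    (\<forall>\<xi>\<in>characters (fixed_center A (torus n) \<alpha>).
      \<exists>z\<in>carrier (fixed_center A (torus n) \<alpha>). \<xi> z \<noteq> 0 \<and>
        trivial_nc_principal_bundle n (localization A z) (loc_action A \<alpha> z))"

end

theory Submission
  imports Defs
begin

text \<open>
  A character \<open>\<chi>\<close> of \<open>Z\<close> satisfies \<open>\<chi> 1 \<noteq> 0\<close>, so it suffices to localize at
  \<open>z = 1\<close>. Evaluation at \<open>t = 1\<close> identifies \<open>A\<^bsub>{1}\<^esub>\<close> with \<open>A\<close>, compatibly with the
  topologies and the actions. Its kernel is the ideal generated by
  \<open>1 - t\<close>, by Hadamard's lemma: a smooth curve vanishing at \<open>1\<close> is \<open>t - 1\<close> times a smooth curve.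
  The evaluation induces a homeomorphism because it is continuous and
  has the continuous section that sends an element to the constant curve.
\<close>

section \<open>Derivatives of curves\<close>

text \<open>The usual proof of Hadamard's lemma writes the quotient as the integral of
  \<open>f' (1 + s * (t - 1))\<close> over the unit interval. \<open>A\<close> is not assumed
  complete, so this integral may have no value in \<open>A\<close>, and the derivatives of the
  quotient at 1 have to be found by estimates. In a locally convex space the available estimate is a
  mean value theorem in terms of sets: a chord slope lies in every open convex set that contains the
  derivatives. It yields a rule of l'Hopital type for Taylor remainders. The lemma puts each curve
  vanishing at 1 into the algebraic ideal, so that taking the closure adds nothing. A second
  obstacle is that the localization lives on another type, sets of curves, and is at first a bare
  record: its axioms, its action and its bundle structure all have to be transported from
  \<open>A\<close>.\<close>

lemma DERIV_diff_power_Suc: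
  "((\<lambda>t::real. (t - a) ^ Suc k) has_real_derivative real (Suc k) * (t - a) ^ k) (at t)"
proof -
  have "((\<lambda>t. t - a) has_real_derivative 1) (at t)" by (auto intro!: derivative_eq_intros)
  from DERIV_power_Suc[OF this, of k] show ?thesis by simp
qed

lemma DERIV_inverse_diff_power_Suc:
  fixes t a :: real
  assumes "t \<noteq> a"
  shows "((\<lambda>t. 1 / (t - a) ^ Suc k) has_real_derivative - real (Suc k) / (t - a) ^ Suc (Suc k)) (at t)"
proof -
  have "- (inverse (u ^ Suc k) * (real (Suc k) * u ^ k) * inverse (u ^ Suc k)) =
      - real (Suc k) / u ^ Suc (Suc k)" if "u \<noteq> 0" for u :: real
    using that by (simp add: field_simps del: of_nat_Suc)
  from this[of "t - a"] show ?thesis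
    using DERIV_inverse'[OF DERIV_diff_power_Suc[of a k t]] assms
    by (simp only: inverse_eq_divide power_eq_0_iff right_minus_eq) simp
qed

context lc_algebra
begin

section \<open>Arithmetic with vectors and complex scalars\<close>

lemma ring_A: "ring A" ..

lemma mult_add_distrib:
  assumes "x \<in> carrier A" "y \<in> carrier A" "z \<in> carrier A"
  shows "(x \<oplus> y) \<otimes> z = x \<otimes> z \<oplus> y \<otimes> z"
    and "z \<otimes> (x \<oplus> y) = z \<otimes> x \<oplus> z \<otimes> y"
  using assms by (simp_all add: ring.ring_simprules[OF ring_A])

lemma add_ac:
  "\<lbrakk>x \<in> carrier A; y \<in> carrier A; z \<in> carrier A\<rbrakk> \<Longrightarrow> x \<oplus> y \<oplus> z = x \<oplus> (y \<oplus> z)"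
  "\<lbrakk>x \<in> carrier A; y \<in> carrier A\<rbrakk> \<Longrightarrow> x \<oplus> y = y \<oplus> x"
  "\<lbrakk>x \<in> carrier A; y \<in> carrier A; z \<in> carrier A\<rbrakk> \<Longrightarrow> x \<oplus> (y \<oplus> z) = y \<oplus> (x \<oplus> z)"
  by (simp_all add: ring.ring_simprules[OF ring_A])

lemma smult_carrier: "x \<in> carrier A \<Longrightarrow> c \<odot> x \<in> carrier A"
  by (rule smult_closed) (simp_all add: ring_of_type_algebra_def)

lemma smult_plus: "x \<in> carrier A \<Longrightarrow> (c + d) \<odot> x = c \<odot> x \<oplus> d \<odot> x"
  using smult_l_distr[of c d x] by (simp add: ring_of_type_algebra_def)

lemma smult_add: "\<lbrakk>x \<in> carrier A; y \<in> carrier A\<rbrakk> \<Longrightarrow> c \<odot> (x \<oplus> y) = c \<odot> x \<oplus> c \<odot> y"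
  using smult_r_distr[of c x y] by (simp add: ring_of_type_algebra_def)

lemma smult_smult: "x \<in> carrier A \<Longrightarrow> c \<odot> (d \<odot> x) = (c * d) \<odot> x"
  using smult_assoc1[of c d x] by (simp add: ring_of_type_algebra_def)

lemma smult_1: "x \<in> carrier A \<Longrightarrow> 1 \<odot> x = x"
  using smult_one[of x] by (simp add: ring_of_type_algebra_def)

lemma smult_0: "x \<in> carrier A \<Longrightarrow> 0 \<odot> x = \<zero>"
  using smult_l_null[of x] by (simp add: ring_of_type_algebra_def)

lemma smult_zero: "c \<odot> \<zero> = \<zero>"
  using smult_r_null[of c] by (simp add: ring_of_type_algebra_def)

lemma a_inv_smult: "x \<in> carrier A \<Longrightarrow> \<ominus> x = (- 1) \<odot> x"
  using smult_plus[of x 1 "- 1"] by (simp add: smult_0 smult_1 smult_carrier abelian_group.minus_equality[OF ring.is_abelian_group[OF ring_A]] add_ac)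

lemma minus_smult: "\<lbrakk>x \<in> carrier A; y \<in> carrier A\<rbrakk> \<Longrightarrow> x \<ominus> y = x \<oplus> (- 1) \<odot> y"
  by (simp add: a_minus_def a_inv_smult)

lemma add_minus_cancel:
  assumes "x \<in> carrier A" "y \<in> carrier A"
  shows "x \<oplus> (y \<ominus> x) = y"
proof -
  have "x \<oplus> (y \<ominus> x) = y \<oplus> (x \<ominus> x)"
    using assms by (simp add: minus_smult smult_carrier add_ac)
  then show ?thesis using assms by (simp add: ring.ring_simprules[OF ring_A])
qed

text \<open>The second form serves sums nested to the right by \<open>add_ac\<close>, where two
  multiples of one vector are followed by further summands.\<close>

lemma smult_combine:
  "x \<in> carrier A \<Longrightarrow> c \<odot> x \<oplus> d \<odot> x = (c + d) \<odot> x"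
  "\<lbrakk>x \<in> carrier A; y \<in> carrier A\<rbrakk> \<Longrightarrow> c \<odot> x \<oplus> (d \<odot> x \<oplus> y) = (c + d) \<odot> x \<oplus> y"
  by (simp_all add: smult_plus smult_carrier add_ac(1))

text \<open>Differences become multiples by -1, scalars are multiplied out and sums are nested to
  the right; identities between difference quotients then reduce to comparing normal forms.\<close>

lemmas smult_simps =
  minus_smult smult_add smult_smult smult_carrier smult_mult_left smult_mult_right add_ac
  smult_combine smult_0 smult_1 smult_zero

section \<open>Limits and rules of differentiation\<close>

lemma limitin_add:
  assumes "limitin (topol A) f a F" "limitin (topol A) g b F"
  shows "limitin (topol A) (\<lambda>x. f x \<oplus> g x) (a \<oplus> b) F"
  using continuous_map_limit[OF continuous_add, of "\<lambda>x. (f x, g x)" "(a, b)" F] assms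
  by (simp add: limitin_pairwise o_def)

lemma limitin_mult:
  assumes "limitin (topol A) f a F" "limitin (topol A) g b F"
  shows "limitin (topol A) (\<lambda>x. f x \<otimes> g x) (a \<otimes> b) F"
  using continuous_map_limit[OF continuous_mult, of "\<lambda>x. (f x, g x)" "(a, b)" F] assms
  by (simp add: limitin_pairwise o_def)

lemma limitin_smult:
  assumes "(\<phi> \<longlongrightarrow> c) F" "limitin (topol A) f a F"
  shows "limitin (topol A) (\<lambda>x. \<phi> x \<odot> f x) (c \<odot> a) F"
  using continuous_map_limit[OF continuous_smult, of "\<lambda>x. (\<phi> x, f x)" "(c, a)" F] assms
  by (simp add: limitin_pairwise o_def)

lemma has_lc_deriv_carrier: "has_lc_deriv A c t l \<Longrightarrow> l \<in> carrier A"
  unfolding has_lc_deriv_def by (metis limitin_topspace topspace_topol)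

text \<open>For nonzero \<open>h\<close>, \<open>c (t + h)\<close> is \<open>c t\<close> plus
  \<open>h\<close> times the difference quotient, and the second summand tends to zero because
  scalar multiplication is jointly continuous.\<close>

lemma has_lc_deriv_continuous:
  assumes c: "\<And>t. c t \<in> carrier A" and d: "has_lc_deriv A c t l"
  shows "limitin (topol A) (\<lambda>h. c (t + h)) (c t) (at 0)"
proof -
  have l: "l \<in> carrier A" using d by (rule has_lc_deriv_carrier)
  have "((\<lambda>h::real. complex_of_real h) \<longlongrightarrow> complex_of_real 0) (at 0)"
    by (intro tendsto_intros)
  from limitin_add[OF _ limitin_smult[OF this d[unfolded has_lc_deriv_def]], of "\<lambda>_. c t" "c t"]
  have "limitin (topol A) (\<lambda>h. c t \<oplus> complex_of_real h \<odot>
      (complex_of_real (1 / h) \<odot> (c (t + h) \<ominus> c t))) (c t)  (at 0)"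
    using c l by (simp add: topspace_topol smult_0)
  moreover have "\<forall>\<^sub>F h in at 0. c t \<oplus> complex_of_real h \<odot>
      (complex_of_real (1 / h) \<odot> (c (t + h) \<ominus> c t)) = c (t + h)"
    unfolding eventually_at
    by (intro exI[of _ 1]) (auto simp: c smult_smult smult_1 add_minus_cancel)
  ultimately show ?thesis by (rule limitin_transform_eventually[rotated])
qed

lemma has_lc_deriv_unique:
  "\<lbrakk>has_lc_deriv A c t l; has_lc_deriv A c t l'\<rbrakk> \<Longrightarrow> l = l'"
  unfolding has_lc_deriv_def by (rule limitin_Hausdorff_unique) (auto simp: Hausdorff)

lemma lc_deriv_eq: "has_lc_deriv A c t l \<Longrightarrow> lc_deriv A c t = l"
  unfolding lc_deriv_def by (blast intro: has_lc_deriv_unique)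

lemma has_lc_deriv_const: "x \<in> carrier A \<Longrightarrow> has_lc_deriv A (\<lambda>_. x) t \<zero>"
  by (simp add: has_lc_deriv_def smult_simps topspace_topol)

lemma has_lc_deriv_add:
  assumes "\<And>t. f t \<in> carrier A" "\<And>t. g t \<in> carrier A"
    and "has_lc_deriv A f t l" "has_lc_deriv A g t m"
  shows "has_lc_deriv A (\<lambda>t. f t \<oplus> g t) t (l \<oplus> m)"
proof -
  have eq: "complex_of_real (1 / h) \<odot> (f (t + h) \<oplus> g (t + h) \<ominus> (f t \<oplus> g t)) =
     complex_of_real (1 / h) \<odot> (f (t + h) \<ominus> f t) \<oplus>
     complex_of_real (1 / h) \<odot> (g (t + h) \<ominus> g t)" for h
    by (simp add: assms smult_simps)
  show ?thesis
    using limitin_add[OF assms(3,4)[unfolded has_lc_deriv_def]]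
    by (simp only: has_lc_deriv_def eq)
qed

text \<open>The increment of the product is split with \<open>g (t + h)\<close>, not
  \<open>g t\<close>, next to the increment of \<open>f\<close>. Hence continuity of
  \<open>g\<close> enters, together with joint continuity of the multiplication.\<close>

lemma has_lc_deriv_mult:
  assumes "\<And>t. f t \<in> carrier A" "\<And>t. g t \<in> carrier A"
    and "has_lc_deriv A f t l" "has_lc_deriv A g t m"
  shows "has_lc_deriv A (\<lambda>t. f t \<otimes> g t) t (l \<otimes> g t \<oplus> f t \<otimes> m)"
proof -
  have eq: "complex_of_real (1 / h) \<odot> (f (t + h) \<otimes> g (t + h) \<ominus> (f t \<otimes> g t)) =
     complex_of_real (1 / h) \<odot> (f (t + h) \<ominus> f t) \<otimes> g (t + h) \<oplus>
     f t \<otimes> (complex_of_real (1 / h) \<odot> (g (t + h) \<ominus> g t))" for h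
    by (simp add: assms smult_simps mult_add_distrib ring.ring_simprules(5)[OF ring_A])
  show ?thesis
    unfolding has_lc_deriv_def eq
    using assms
    by (intro limitin_add limitin_mult has_lc_deriv_continuous[OF assms(2,4)])
      (auto simp: has_lc_deriv_def topspace_topol)
qed

lemma has_lc_deriv_scale:
  fixes \<phi> :: "real \<Rightarrow> real"
  assumes "\<And>t. f t \<in> carrier A"
    and "(\<phi> has_real_derivative r) (at t)" "has_lc_deriv A f t l"
  shows "has_lc_deriv A (\<lambda>t. complex_of_real (\<phi> t) \<odot> f t) t
    (complex_of_real r \<odot> f t \<oplus> complex_of_real (\<phi> t) \<odot> l)"
proof -
  have eq: "complex_of_real (1 / h) \<odot> (complex_of_real (\<phi> (t + h)) \<odot> f (t + h) \<ominus>
        complex_of_real (\<phi> t) \<odot> f t) =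
      complex_of_real ((\<phi> (t + h) - \<phi> t) / h) \<odot> f (t + h) \<oplus>
      complex_of_real (\<phi> t) \<odot> (complex_of_real (1 / h) \<odot> (f (t + h) \<ominus> f t))" for h
    by (simp add: assms smult_simps diff_divide_distrib)
  show ?thesis
    unfolding has_lc_deriv_def eq
    using assms
    by (intro limitin_add limitin_smult has_lc_deriv_continuous tendsto_of_real)
      (auto simp: has_lc_deriv_def DERIV_def)
qed

text \<open>\<open>L\<close> maps difference quotients to difference quotients, so its continuity
  carries the limit over. This serves both scalar multiples and the automorphisms of the
  action.\<close>

lemma has_lc_deriv_linear:
  assumes "continuous_map (topol A) (topol A) L"
    and "\<And>x y. \<lbrakk>x \<in> carrier A; y \<in> carrier A\<rbrakk> \<Longrightarrow> L (x \<oplus> y) = L x \<oplus> L y"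
    and "\<And>c x. x \<in> carrier A \<Longrightarrow> L (c \<odot> x) = c \<odot> L x"
    and "\<And>t. f t \<in> carrier A" "has_lc_deriv A f t l"
  shows "has_lc_deriv A (\<lambda>t. L (f t)) t (L l)"
proof -
  have L: "L x \<in> carrier A" if "x \<in> carrier A" for x
    using assms(1) that by (auto simp: continuous_map_def topspace_topol)
  have eq: "complex_of_real (1 / h) \<odot> (L (f (t + h)) \<ominus> L (f t)) =
      L (complex_of_real (1 / h) \<odot> (f (t + h) \<ominus> f t))" for h
    by (simp add: assms L minus_smult smult_carrier)
  show ?thesis
    using continuous_map_limit[OF assms(1) assms(5)[unfolded has_lc_deriv_def]]
    by (simp only: has_lc_deriv_def eq o_def)
qed

lemma has_lc_deriv_transform:
  assumes "has_lc_deriv A f t l" "open S" "t \<in> S" "\<And>s. s \<in> S \<Longrightarrow> f s = g s"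
  shows "has_lc_deriv A g t l"
proof -
  have "\<forall>\<^sub>F h in at (0::real). t + h \<in> S"
  proof -
    have "((\<lambda>h. t + h) \<longlongrightarrow> t + 0) (at 0)" by (intro tendsto_intros)
    then show ?thesis using assms(2,3) by (auto dest: topological_tendstoD)
  qed
  then have "\<forall>\<^sub>F h in at 0. complex_of_real (1 / h) \<odot> (f (t + h) \<ominus> f t) =
      complex_of_real (1 / h) \<odot> (g (t + h) \<ominus> g t)"
    by eventually_elim (simp add: assms)
  then show ?thesis
    using assms(1) unfolding has_lc_deriv_def by (rule limitin_transform_eventually)
qed

section \<open>The mean value theorem in convex sets\<close>

lemma continuous_map_smult: "continuous_map (topol A) (topol A) (\<lambda>x. c \<odot> x)"
  using continuous_map_compose[OF _ continuous_smult, of "topol A" "\<lambda>x. (c, x)"]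
  by (simp add: o_def continuous_map_pairwise)

lemma minus_add_minus:
  assumes "x \<in> carrier A" "y \<in> carrier A" "z \<in> carrier A"
  shows "(y \<ominus> x) \<oplus> (z \<ominus> y) = z \<ominus> x"
proof -
  have "(y \<ominus> x) \<oplus> (z \<ominus> y) = (y \<oplus> (z \<ominus> y)) \<ominus> x"
    using assms by (simp add: minus_smult smult_carrier add_ac)
  then show ?thesis using assms by (simp add: add_minus_cancel)
qed

text \<open>Convexity is worded as in the axiom \<open>locally_convex\<close>, so the sets which
  that axiom provides qualify at once.\<close>

definition convex_nhd :: "'a set \<Rightarrow> bool" where
  "convex_nhd V \<longleftrightarrow> openin (topol A) V \<and>
    (\<forall>x\<in>V. \<forall>y\<in>V. \<forall>s::real. 0 \<le> s \<and> s \<le> 1 \<longrightarrow>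
      complex_of_real s \<odot> x \<oplus> complex_of_real (1 - s) \<odot> y \<in> V)"

text \<open>This turns a condition on scaled derivatives into one on the derivatives themselves, as
  \<open>mean_value\<close> expects it.\<close>

lemma convex_nhd_vimage_smult:
  assumes "convex_nhd V"
  shows "convex_nhd {x \<in> carrier A. c \<odot> x \<in> V}"
  unfolding convex_nhd_def
proof (intro conjI ballI allI impI)
  show "openin (topol A) {x \<in> carrier A. c \<odot> x \<in> V}"
    using openin_continuous_map_preimage[OF continuous_map_smult[of c], of V] assms
    by (simp add: convex_nhd_def topspace_topol)
next
  fix x y and s :: real
  assume *: "x \<in> {x \<in> carrier A. c \<odot> x \<in> V}" "y \<in> {x \<in> carrier A. c \<odot> x \<in> V}"
    "0 \<le> s \<and> s \<le> 1"
  then have "complex_of_real s \<odot> (c \<odot> x) \<oplus> complex_of_real (1 - s) \<odot> (c \<odot> y) \<in> V"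
    using assms unfolding convex_nhd_def by blast
  then show "complex_of_real s \<odot> x \<oplus> complex_of_real (1 - s) \<odot> y \<in> {x \<in> carrier A. c \<odot> x \<in> V}"
    using * by (simp add: smult_add smult_smult smult_carrier mult.commute)
qed

definition diff_quot :: "(real \<Rightarrow> 'a) \<Rightarrow> real \<Rightarrow> real \<Rightarrow> 'a" where
  "diff_quot c x y = complex_of_real (1 / (y - x)) \<odot> (c y \<ominus> c x)"

lemma diff_quot_commute:
  assumes "\<And>t. c t \<in> carrier A"
  shows "diff_quot c x y = diff_quot c y x"
proof -
  have "complex_of_real (1 / (y - x)) = - complex_of_real (1 / (x - y))"
    by (metis minus_diff_eq minus_divide_right of_real_minus)
  then show ?thesis
    using assms by (simp only: diff_quot_def minus_smult smult_add smult_smult smult_carrier)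
      (simp add: assms smult_carrier add_ac)
qed

text \<open>The slope over the whole interval is the mean of the slopes over its two pieces,
  weighted by their lengths.\<close>

lemma diff_quot_convex_combination:
  assumes c: "\<And>t. c t \<in> carrier A" and V: "convex_nhd V" and "x < y" "y < z"
    and q: "diff_quot c x y \<in> V" "diff_quot c y z \<in> V"
  shows "diff_quot c x z \<in> V"
proof -
  define s where "s = (y - x) / (z - x)"
  have s: "0 \<le> s" "s \<le> 1" using assms by (auto simp: s_def)
  have r1: "complex_of_real s * complex_of_real (1 / (y - x)) = complex_of_real (1 / (z - x))"
    using assms unfolding of_real_mult[symmetric] s_def by simp
  have "1 - s = (z - y) / (z - x)" using assms by (simp add: s_def field_simps)
  then have r2: "complex_of_real (1 - s) * complex_of_real (1 / (z - y)) = complex_of_real (1 / (z - x))"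
    using assms unfolding of_real_mult[symmetric] by simp
  have m: "c u \<ominus> c v \<in> carrier A" for u v
    by (simp add: minus_smult c smult_carrier)
  have "complex_of_real s \<odot> diff_quot c x y \<oplus> complex_of_real (1 - s) \<odot> diff_quot c y z \<in> V"
    using V s q unfolding convex_nhd_def by blast
  also have "complex_of_real s \<odot> diff_quot c x y \<oplus> complex_of_real (1 - s) \<odot> diff_quot c y z =
      diff_quot c x z"
    unfolding diff_quot_def
    by (simp only: smult_smult[OF m] r1 r2 smult_add[OF m m, symmetric]
        minus_add_minus[OF c c c])
  finally show ?thesis .
qed

text \<open>Having a slope in \<open>V\<close> passes from adjacent intervals to their union by
  convexity, and it holds for short intervals around any point because the derivative there lies in
  the open set \<open>V\<close>. Bisection extends it to the full interval.\<close>

lemma mean_value: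
  assumes c: "\<And>t. c t \<in> carrier A" and V: "convex_nhd V" and "a < b"
    and d: "\<And>t. a \<le> t \<Longrightarrow> t \<le> b \<Longrightarrow> \<exists>l\<in>V. has_lc_deriv A c t l"
  shows "diff_quot c a b \<in> V"
proof -
  \<comment> \<open>\<open>Bolzano\<close> also ranges over degenerate intervals. Their slope is the
    zero vector, since \<open>1 / 0 = 0\<close>, and may lie outside \<open>V\<close>; the guard
    excludes them.\<close>
  have "a < b \<longrightarrow> diff_quot c a b \<in> V"
  proof (rule Bolzano[where P = "\<lambda>x y. x < y \<longrightarrow> diff_quot c x y \<in> V"])
    show "a \<le> b" using \<open>a < b\<close> by simp
  next
    fix x y z
    assume *: "x < y \<longrightarrow> diff_quot c x y \<in> V" "y < z \<longrightarrow> diff_quot c y z \<in> V" "x \<le> y" "y \<le> z"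
    show "x < z \<longrightarrow> diff_quot c x z \<in> V"
    proof (cases "x < y \<and> y < z")
      case True
      then have "diff_quot c x z \<in> V"
        using * by (intro diff_quot_convex_combination[of c V x y z, OF c V]) blast+
      then show ?thesis by blast
    next
      case False
      then have "x = y \<or> y = z" using *(3,4) by linarith
      then show ?thesis using *(1,2) by blast
    qed
  next
    fix x assume "a \<le> x" "x \<le> b"
    then obtain l where l: "l \<in> V" "has_lc_deriv A c x l" using d by blast
    have "\<forall>\<^sub>F h in at 0. complex_of_real (1 / h) \<odot> (c (x + h) \<ominus> c x) \<in> V"
      using l V unfolding has_lc_deriv_def convex_nhd_def by (auto dest: limitinD)
    then obtain e where e: "e > 0"
      "\<And>h. h \<noteq> 0 \<Longrightarrow> \<bar>h\<bar> < e \<Longrightarrow> complex_of_real (1 / h) \<odot> (c (x + h) \<ominus> c x) \<in> V"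
      unfolding eventually_at by (auto simp: dist_real_def)
    have q: "diff_quot c x y \<in> V" if "y \<noteq> x" "\<bar>y - x\<bar> < e" for y
      using e(2)[of "y - x"] that by (simp add: diff_quot_def)
    \<comment> \<open>Differentiability at \<open>x\<close> controls only slopes with one endpoint
      at \<open>x\<close>, so an interval with \<open>x\<close> in its interior is cut
      there.\<close>
    have "diff_quot c u v \<in> V" if "u \<le> x" "x \<le> v" "v - u < e" "u < v" for u v
    proof (cases "u = x \<or> v = x")
      case True
      then show ?thesis using q[of v] q[of u] diff_quot_commute[of c u v, OF c] that by auto
    next
      case False
      then have "diff_quot c x u \<in> V" "diff_quot c x v \<in> V" using q that by auto
      then show ?thesis
        using diff_quot_convex_combination[of c V u x v, OF c V] diff_quot_commute[of c u x, OF c] that False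
        by simp
    qed
    then show "\<exists>d>0. \<forall>u v. u \<le> x \<and> x \<le> v \<and> v - u < d \<longrightarrow> u < v \<longrightarrow> diff_quot c u v \<in> V"
      using e(1) by (intro exI[of _ e]) simp
  qed
  with \<open>a < b\<close> show ?thesis by simp
qed

text \<open>A rule of l'Hopital type: if \<open>R'\<close> is small compared with the
  \<open>m\<close>-th power of the increment, the mean value theorem between \<open>a\<close> and
  \<open>a + h\<close> gains one more power for \<open>R\<close>.\<close>

lemma limitin_derivative_quotient:
  assumes R: "\<And>t. R t \<in> carrier A" and d: "\<And>t. has_lc_deriv A R t (R' t)"
    and "R a = \<zero>" "R' a = \<zero>"
    and lim: "limitin (topol A) (\<lambda>h. complex_of_real (1 / h ^ m) \<odot> R' (a + h)) \<zero> (at 0)"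
  shows "limitin (topol A) (\<lambda>h. complex_of_real (1 / h ^ Suc m) \<odot> R (a + h)) \<zero> (at 0)"
  unfolding limitin_def
proof (intro conjI allI impI)
  show "\<zero> \<in> topspace (topol A)" by (simp add: topspace_topol)
next
  fix U assume "openin (topol A) U \<and> \<zero> \<in> U"
  then obtain V where V: "convex_nhd V" "\<zero> \<in> V" "V \<subseteq> U"
    using locally_convex[of U] unfolding convex_nhd_def by auto
  have R': "R' t \<in> carrier A" for t using d by (rule has_lc_deriv_carrier)
  have "\<forall>\<^sub>F h in at 0. complex_of_real (1 / h ^ m) \<odot> R' (a + h) \<in> V"
    using lim V unfolding convex_nhd_def by (auto dest: limitinD)
  then obtain e where e: "e > 0"
      "\<And>h. h \<noteq> 0 \<Longrightarrow> \<bar>h\<bar> < e \<Longrightarrow> complex_of_real (1 / h ^ m) \<odot> R' (a + h) \<in> V"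
    unfolding eventually_at by (auto simp: dist_real_def)
  have "complex_of_real (1 / h ^ Suc m) \<odot> R (a + h) \<in> U" if h: "h \<noteq> 0" "\<bar>h\<bar> < e" for h
  proof -
    \<comment> \<open>With \<open>h\<close> fixed, \<open>W\<close> holds the vectors that
      \<open>1 / h ^ m\<close> scales into \<open>V\<close>. All derivatives between
      \<open>a\<close> and \<open>a + h\<close> must lie in this one set, although the limit scales
      each of them by its own increment \<open>k\<close>.\<close>
    define W where "W = {x \<in> carrier A. complex_of_real (1 / h ^ m) \<odot> x \<in> V}"
    have W: "convex_nhd W" unfolding W_def using V(1) by (rule convex_nhd_vimage_smult)
    have R'_W: "R' (a + k) \<in> W" if "0 \<le> k / h" "k / h \<le> 1" for k
    proof (cases "k = 0")
      case True
      \<comment> \<open>The limit speaks of nonzero increments only, so the value at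
        \<open>a\<close> itself has to come from \<open>R' a = \<zero>\<close>.\<close>
      then show ?thesis using V \<open>R' a = \<zero>\<close> by (simp add: W_def smult_zero)
    next
      case False
      \<comment> \<open>This factor changes the scale from \<open>k\<close> to \<open>h\<close>:
        \<open>R' (a + k)\<close> divided by \<open>h ^ m\<close> is a convex combination, with
        weights \<open>s\<close> and \<open>1 - s\<close>, of \<open>R' (a + k)\<close> divided by
        \<open>k ^ m\<close> and the zero vector.\<close>
      define s where "s = (k / h) ^ m"
      have s: "0 \<le> s" "s \<le> 1" using that by (auto simp: s_def power_le_one)
      have "\<bar>k\<bar> \<le> \<bar>h\<bar>" using that h by (auto simp: divide_simps split: if_splits)
      then have "complex_of_real (1 / k ^ m) \<odot> R' (a + k) \<in> V" using e(2)[of k] False h by simp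
      then have "complex_of_real s \<odot> (complex_of_real (1 / k ^ m) \<odot> R' (a + k)) \<oplus>
          complex_of_real (1 - s) \<odot> \<zero> \<in> V"
        using V(1,2) s unfolding convex_nhd_def by blast
      moreover have "complex_of_real s * complex_of_real (1 / k ^ m) = complex_of_real (1 / h ^ m)"
        unfolding of_real_mult[symmetric] s_def using False by (simp add: power_divide)
      ultimately show ?thesis
        using R' by (simp only: W_def smult_smult smult_zero) (simp add: smult_carrier)
    qed
    have "diff_quot R a (a + h) \<in> W"
    proof (cases "h > 0")
      case True
      show ?thesis
      proof (rule mean_value[of R W, OF R W])
        fix t assume "a \<le> t" "t \<le> a + h"
        then show "\<exists>l\<in>W. has_lc_deriv A R t l"
          using R'_W[of "t - a"] d True by (intro bexI[of _ "R' t"]) auto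
      qed (use True in simp)
    next
      case False
      have "diff_quot R (a + h) a \<in> W"
      proof (rule mean_value[of R W, OF R W])
        fix t assume "a + h \<le> t" "t \<le> a"
        then show "\<exists>l\<in>W. has_lc_deriv A R t l"
          using R'_W[of "t - a"] d False h
          by (intro bexI[of _ "R' t"]) (auto simp: divide_simps)
      qed (use False h in simp)
      then show ?thesis by (simp add: diff_quot_commute[of R a, OF R])
    qed
    moreover have "complex_of_real (1 / h ^ m) \<odot> diff_quot R a (a + h) =
        complex_of_real (1 / h ^ Suc m) \<odot> R (a + h)"
      using R h \<open>R a = \<zero>\<close> by (simp add: diff_quot_def minus_smult smult_zero smult_smult mult.commute)
    ultimately show ?thesis using V(3) by (auto simp: W_def)
  qed
  then show "\<forall>\<^sub>F h in at 0. complex_of_real (1 / h ^ Suc m) \<odot> R (a + h) \<in> U"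
    unfolding eventually_at using e(1) by (auto simp: dist_real_def intro!: exI[of _ e])
qed

lemma has_lc_deriv_scale_const:
  fixes \<phi> :: "real \<Rightarrow> real"
  assumes "x \<in> carrier A" "(\<phi> has_real_derivative r) (at t)"
  shows "has_lc_deriv A (\<lambda>t. complex_of_real (\<phi> t) \<odot> x) t (complex_of_real r \<odot> x)"
  using has_lc_deriv_scale[OF _ assms(2) has_lc_deriv_const[OF assms(1)]] assms(1)
  by (simp add: smult_zero smult_carrier)

section \<open>Smooth curves and the Hadamard lemma\<close>

lemma smooth_curves_carrier: "f \<in> smooth_curves A \<Longrightarrow> f t \<in> carrier A"
  by (simp add: smooth_curves_def)

lemma smooth_curves_deriv:
  assumes "f \<in> smooth_curves A"
  obtains f' where "f' \<in> smooth_curves A" "\<And>t. has_lc_deriv A f t (f' t)"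
proof -
  obtain D where D: "D 0 = f" "\<And>k t. has_lc_deriv A (D k) t (D (Suc k) t)"
    using assms unfolding smooth_curves_def by blast
  have "D (Suc 0) \<in> smooth_curves A"
    unfolding smooth_curves_def using D(2) has_lc_deriv_carrier[OF D(2)]
    by (auto intro!: exI[of _ "\<lambda>k. D (Suc k)"])
  then show thesis using that D by metis
qed

text \<open>A derivative inside \<open>S\<close> is chosen for every member of \<open>S\<close>;
  iterating the choice from \<open>f\<close> produces the whole sequence of derivatives at
  once.\<close>

lemma smooth_curves_coinduct:
  assumes "f \<in> S"
    and S: "\<And>f. f \<in> S \<Longrightarrow> (\<forall>t. f t \<in> carrier A) \<and> (\<exists>f'\<in>S. \<forall>t. has_lc_deriv A f t (f' t))"
  shows "f \<in> smooth_curves A"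
proof -
  obtain d where d: "\<And>f. f \<in> S \<Longrightarrow> d f \<in> S \<and> (\<forall>t. has_lc_deriv A f t (d f t))"
    using S by metis
  define D where "D k = (d ^^ k) f" for k
  have "D k \<in> S" for k by (induction k) (simp_all add: D_def assms d)
  then have "has_lc_deriv A (D k) t (D (Suc k) t)" for k t
    using d by (simp add: D_def)
  moreover have "D 0 = f" by (simp add: D_def)
  ultimately show ?thesis using S[OF \<open>f \<in> S\<close>] unfolding smooth_curves_def by blast
qed

lemma smooth_curves_const: "x \<in> carrier A \<Longrightarrow> (\<lambda>_. x) \<in> smooth_curves A"
  by (rule smooth_curves_coinduct[of _ "{\<lambda>_. x |x. x \<in> carrier A}"])
    (auto intro!: has_lc_deriv_const)

lemma smooth_curves_add:
  assumes "f \<in> smooth_curves A" "g \<in> smooth_curves A"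
  shows "(\<lambda>t. f t \<oplus> g t) \<in> smooth_curves A"
proof (rule smooth_curves_coinduct)
  let ?S = "{\<lambda>t. f t \<oplus> g t |f g. f \<in> smooth_curves A \<and> g \<in> smooth_curves A}"
  show "(\<lambda>t. f t \<oplus> g t) \<in> ?S" using assms by blast
  fix u assume "u \<in> ?S"
  then obtain f g where u: "u = (\<lambda>t. f t \<oplus> g t)" and fg: "f \<in> smooth_curves A" "g \<in> smooth_curves A"
    by blast
  obtain f' g' where d: "f' \<in> smooth_curves A" "\<And>t. has_lc_deriv A f t (f' t)"
    "g' \<in> smooth_curves A" "\<And>t. has_lc_deriv A g t (g' t)"
    using fg by (meson smooth_curves_deriv)
  have "has_lc_deriv A u t (f' t \<oplus> g' t)" for t
    unfolding u using fg d by (intro has_lc_deriv_add) (simp_all add: smooth_curves_carrier)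
  moreover have "(\<lambda>t. f' t \<oplus> g' t) \<in> ?S" using d by blast
  moreover have "u t \<in> carrier A" for t using fg by (simp add: u smooth_curves_carrier)
  ultimately show "(\<forall>t. u t \<in> carrier A) \<and> (\<exists>u'\<in>?S. \<forall>t. has_lc_deriv A u t (u' t))"
    by (intro conjI allI bexI)
qed

lemma smooth_curves_linear:
  assumes L: "continuous_map (topol A) (topol A) L"
    "\<And>x y. \<lbrakk>x \<in> carrier A; y \<in> carrier A\<rbrakk> \<Longrightarrow> L (x \<oplus> y) = L x \<oplus> L y"
    "\<And>c x. x \<in> carrier A \<Longrightarrow> L (c \<odot> x) = c \<odot> L x"
    and "f \<in> smooth_curves A"
  shows "(\<lambda>t. L (f t)) \<in> smooth_curves A"
proof (rule smooth_curves_coinduct)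
  let ?S = "{\<lambda>t. L (f t) |f. f \<in> smooth_curves A}"
  show "(\<lambda>t. L (f t)) \<in> ?S" using assms(4) by blast
  fix u assume "u \<in> ?S"
  then obtain f where u: "u = (\<lambda>t. L (f t))" and f: "f \<in> smooth_curves A" by blast
  obtain f' where "f' \<in> smooth_curves A" "\<And>t. has_lc_deriv A f t (f' t)"
    using f by (meson smooth_curves_deriv)
  moreover have "L x \<in> carrier A" if "x \<in> carrier A" for x
    using L(1) that by (auto simp: continuous_map_def topspace_topol)
  ultimately show "(\<forall>t. u t \<in> carrier A) \<and> (\<exists>u'\<in>?S. \<forall>t. has_lc_deriv A u t (u' t))"
    unfolding u using f
    by (auto simp: smooth_curves_carrier
        intro!: has_lc_deriv_linear[OF L] bexI[of _ "\<lambda>t. L (f' t)"])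
qed

lemma smooth_curves_smult:
  "f \<in> smooth_curves A \<Longrightarrow> (\<lambda>t. c \<odot> f t) \<in> smooth_curves A"
  by (rule smooth_curves_linear[OF continuous_map_smult])
    (simp_all add: smult_add smult_smult mult.commute)

text \<open>
  Derivatives of products are sums of products, so the coinduction needs the closure of the
  products under sums.
\<close>

inductive_set sums_of_products :: "(real \<Rightarrow> 'a) set" where
  product: "\<lbrakk>f \<in> smooth_curves A; g \<in> smooth_curves A\<rbrakk> \<Longrightarrow> (\<lambda>t. f t \<otimes> g t) \<in> sums_of_products"
| sum: "\<lbrakk>u \<in> sums_of_products; v \<in> sums_of_products\<rbrakk> \<Longrightarrow> (\<lambda>t. u t \<oplus> v t) \<in> sums_of_products"

lemma smooth_curves_mult:
  assumes "f \<in> smooth_curves A" "g \<in> smooth_curves A"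
  shows "(\<lambda>t. f t \<otimes> g t) \<in> smooth_curves A"
proof (rule smooth_curves_coinduct)
  show "(\<lambda>t. f t \<otimes> g t) \<in> sums_of_products" using assms by (rule product)
  fix u assume "u \<in> sums_of_products"
  then show "(\<forall>t. u t \<in> carrier A) \<and> (\<exists>u'\<in>sums_of_products. \<forall>t. has_lc_deriv A u t (u' t))"
  proof induction
    case (product f g)
    obtain f' g' where "f' \<in> smooth_curves A" "\<And>t. has_lc_deriv A f t (f' t)"
      "g' \<in> smooth_curves A" "\<And>t. has_lc_deriv A g t (g' t)"
      using product by (meson smooth_curves_deriv)
    then show ?case
      using product by (auto simp: smooth_curves_carrier
          intro!: has_lc_deriv_mult sums_of_products.intros bexI[of _ "\<lambda>t. f' t \<otimes> g t \<oplus> f t \<otimes> g' t"])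
  next
    case (sum u v)
    then obtain u' v' where "u' \<in> sums_of_products" "\<And>t. has_lc_deriv A u t (u' t)"
      "v' \<in> sums_of_products" "\<And>t. has_lc_deriv A v t (v' t)" by blast
    then show ?case
      using sum by (auto intro!: has_lc_deriv_add sums_of_products.intros bexI[of _ "\<lambda>t. u' t \<oplus> v' t"])
  qed
qed

text \<open>The derivative is the constant curve \<open>x\<close>, so adjoining this one curve to
  the smooth curves keeps the set closed under differentiation. The curve occurs in the generator of
  the localizing ideal.\<close>

lemma smooth_curves_real_smult:
  assumes "x \<in> carrier A"
  shows "(\<lambda>t. complex_of_real t \<odot> x) \<in> smooth_curves A"
proof (rule smooth_curves_coinduct)
  let ?S = "insert (\<lambda>t. complex_of_real t \<odot> x) (smooth_curves A)"
  show "(\<lambda>t. complex_of_real t \<odot> x) \<in> ?S" by simp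
  fix u assume "u \<in> ?S"
  then show "(\<forall>t. u t \<in> carrier A) \<and> (\<exists>u'\<in>?S. \<forall>t. has_lc_deriv A u t (u' t))"
  proof
    assume u: "u = (\<lambda>t. complex_of_real t \<odot> x)"
    have "has_lc_deriv A u t x" for t
      using has_lc_deriv_scale_const[OF assms DERIV_ident] by (simp add: u smult_1 assms)
    then show ?thesis
      using smooth_curves_const[OF assms] by (auto simp: u smult_carrier assms intro!: bexI[of _ "\<lambda>_. x"])
  next
    assume "u \<in> smooth_curves A"
    then show ?thesis by (metis insert_iff smooth_curves_carrier smooth_curves_deriv)
  qed
qed

text \<open>
  The \<open>k\<close>-th derivative \<open>G k\<close> of the quotient \<open>f / (t - a)\<close> is
  \<open>H k / (t - a)\<^sup>k\<^sup>+\<^sup>1\<close>, where \<open>H k\<close> has the derivative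
  \<open>(t - a)\<^sup>k f\<^sup>(\<^sup>k\<^sup>+\<^sup>1\<^sup>)\<close>. At \<open>a\<close>, comparing \<open>H k\<close> with its
  second order Taylor polynomial yields the derivative of \<open>G k\<close>; completeness of
  the algebra is not needed since no integrals occur.
\<close>

lemma smooth_curves_divide:
  assumes f: "f \<in> smooth_curves A" and fa: "f a = \<zero>"
  obtains g where "g \<in> smooth_curves A" "\<And>t. f t = complex_of_real (t - a) \<odot> g t"
proof -
  obtain D where D0: "D 0 = f" and D: "\<And>k t. has_lc_deriv A (D k) t (D (Suc k) t)"
    using f unfolding smooth_curves_def by blast
  have Dc: "D k t \<in> carrier A" for k t
    using smooth_curves_carrier[OF f] has_lc_deriv_carrier[OF D] D0 by (cases k) auto
  \<comment> \<open>The recursion is the quotient rule: the derivative of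
    \<open>H k / (t - a) ^ Suc k\<close> has, over \<open>(t - a) ^ Suc (Suc k)\<close>, the
    numerator \<open>(t - a)\<close> times the derivative of \<open>H k\<close> minus
    \<open>Suc k\<close> times \<open>H k\<close>.\<close>
  define H where "H = rec_nat (D 0) (\<lambda>k Hk t. complex_of_real ((t - a) ^ Suc k) \<odot> D (Suc k) t \<oplus>
    complex_of_real (- real (Suc k)) \<odot> Hk t)"
  have H0: "H 0 = D 0" and HS: "H (Suc k) = (\<lambda>t. complex_of_real ((t - a) ^ Suc k) \<odot> D (Suc k) t \<oplus>
    complex_of_real (- real (Suc k)) \<odot> H k t)" for k
    by (simp_all add: H_def)
  have Hc: "H k t \<in> carrier A" for k t
    by (induction k) (simp_all add: H0 HS Dc smult_carrier)
  have Ha: "H k a = \<zero>" for k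
    by (induction k) (simp_all add: H0 HS D0 fa Dc smult_0 smult_zero)
  \<comment> \<open>In the induction, differentiating the power in the first summand of
    \<open>H (Suc k)\<close> gives a multiple of \<open>D (Suc k) t\<close> that cancels against the
    derivative of the second summand.\<close>
  have H_deriv: "has_lc_deriv A (H k) t (complex_of_real ((t - a) ^ k) \<odot> D (Suc k) t)" for k t
  proof (induction k)
    case 0
    show ?case using D[of 0] by (simp add: H0 smult_1 Dc)
  next
    case (Suc k)
    have "((\<lambda>t. (t - a) ^ Suc k) has_real_derivative real (Suc k) * (t - a) ^ k) (at t)"
      by (rule DERIV_diff_power_Suc)
    from has_lc_deriv_scale[of "D (Suc k)", OF Dc this D]
    have "has_lc_deriv A (\<lambda>t. complex_of_real ((t - a) ^ Suc k) \<odot> D (Suc k) t) t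
      (complex_of_real (real (Suc k) * (t - a) ^ k) \<odot> D (Suc k) t \<oplus>
       complex_of_real ((t - a) ^ Suc k) \<odot> D (Suc (Suc k)) t)" .
    moreover have "has_lc_deriv A (\<lambda>t. complex_of_real (- real (Suc k)) \<odot> H k t) t
       (complex_of_real (- real (Suc k)) \<odot> (complex_of_real ((t - a) ^ k) \<odot> D (Suc k) t))"
      by (rule has_lc_deriv_linear[where f = "H k", OF continuous_map_smult _ _ Hc Suc])
        (simp_all add: smult_add smult_smult mult.commute)
    ultimately have "has_lc_deriv A (H (Suc k)) t
      ((complex_of_real (real (Suc k) * (t - a) ^ k) \<odot> D (Suc k) t \<oplus>
       complex_of_real ((t - a) ^ Suc k) \<odot> D (Suc (Suc k)) t) \<oplus>
       complex_of_real (- real (Suc k)) \<odot> (complex_of_real ((t - a) ^ k) \<odot> D (Suc k) t))"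
      unfolding HS by (intro has_lc_deriv_add) (simp_all add: smult_carrier Dc Hc del: of_real_minus)
    also have "(complex_of_real (real (Suc k) * (t - a) ^ k) \<odot> D (Suc k) t \<oplus>
       complex_of_real ((t - a) ^ Suc k) \<odot> D (Suc (Suc k)) t) \<oplus>
       complex_of_real (- real (Suc k)) \<odot> (complex_of_real ((t - a) ^ k) \<odot> D (Suc k) t) =
       complex_of_real (real (Suc k) * (t - a) ^ k) \<odot> D (Suc k) t \<oplus>
       (complex_of_real (- real (Suc k)) * complex_of_real ((t - a) ^ k)) \<odot> D (Suc k) t \<oplus>
       complex_of_real ((t - a) ^ Suc k) \<odot> D (Suc (Suc k)) t"
      using Dc by (simp only: smult_smult smult_carrier add_ac)
    also have "\<dots> = complex_of_real ((t - a) ^ Suc k) \<odot> D (Suc (Suc k)) t"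
    proof -
      have "complex_of_real (real (Suc k) * (t - a) ^ k) +
          complex_of_real (- real (Suc k)) * complex_of_real ((t - a) ^ k) = 0"
        by (simp add: algebra_simps)
      then show ?thesis
        using Dc by (simp only: smult_combine smult_carrier smult_0)
          (simp add: ring.ring_simprules[OF ring_A] smult_carrier)
    qed
    finally show ?case .
  qed
  \<comment> \<open>The value at \<open>a\<close> is forced by Leibniz: if \<open>f\<close> is
    \<open>t - a\<close> times \<open>g\<close>, then the derivative of order \<open>k + 1\<close>
    of \<open>f\<close> at \<open>a\<close> is \<open>k + 1\<close> times the derivative of order
    \<open>k\<close> of \<open>g\<close>.\<close>
  define G where "G k t = (if t = a then complex_of_real (1 / real (Suc k)) \<odot> D (Suc k) a
    else complex_of_real (1 / (t - a) ^ Suc k) \<odot> H k t)" for k t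
  have Gc: "G k t \<in> carrier A" for k t by (simp add: G_def smult_carrier Dc Hc)
  have G_deriv: "has_lc_deriv A (G k) t (G (Suc k) t)" for k t
  proof (cases "t = a")
    case False
    have "((\<lambda>t. 1 / (t - a) ^ Suc k) has_real_derivative - real (Suc k) / (t - a) ^ Suc (Suc k)) (at t)"
      using False by (rule DERIV_inverse_diff_power_Suc)
    from has_lc_deriv_scale[of "H k", OF Hc this H_deriv]
    have "has_lc_deriv A (\<lambda>t. complex_of_real (1 / (t - a) ^ Suc k) \<odot> H k t) t
       (complex_of_real (- real (Suc k) / (t - a) ^ Suc (Suc k)) \<odot> H k t \<oplus>
        complex_of_real (1 / (t - a) ^ Suc k) \<odot> (complex_of_real ((t - a) ^ k) \<odot> D (Suc k) t))" .
    also have "complex_of_real (1 / (t - a) ^ Suc k) \<odot> (complex_of_real ((t - a) ^ k) \<odot> D (Suc k) t) =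
        complex_of_real (1 / (t - a)) \<odot> D (Suc k) t"
      using False Dc by (simp add: smult_smult)
    also have "complex_of_real (- real (Suc k) / (t - a) ^ Suc (Suc k)) \<odot> H k t \<oplus>
        complex_of_real (1 / (t - a)) \<odot> D (Suc k) t = G (Suc k) t"
    proof -
      have "complex_of_real (1 / (t - a) ^ Suc (Suc k)) * complex_of_real ((t - a) ^ Suc k) =
          complex_of_real (1 / (t - a))"
        "complex_of_real (1 / (t - a) ^ Suc (Suc k)) * complex_of_real (- real (Suc k)) =
          complex_of_real (- real (Suc k) / (t - a) ^ Suc (Suc k))"
        unfolding of_real_mult[symmetric] using False by simp_all
      then show ?thesis
        using False Hc Dc by (simp only: G_def HS if_False smult_add smult_smult smult_carrier add_ac)
    qed
    finally show ?thesis
      by (rule has_lc_deriv_transform[where S = "- {a}"]) (use False in \<open>auto simp: G_def\<close>)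
  next
    case True
    define F F' where "F = D (Suc k) a" and "F' = D (Suc (Suc k)) a"
    have Fc: "F \<in> carrier A" "F' \<in> carrier A" by (simp_all add: F_def F'_def Dc)
    \<comment> \<open>The derivative of \<open>H k\<close> is close to \<open>(t - a) ^ k\<close>
      times \<open>F\<close> plus \<open>(t - a)\<close> times \<open>F'\<close>. Integrating this
      polynomial gives the two subtracted terms with denominators \<open>k + 1\<close> and
      \<open>k + 2\<close>; \<open>R\<close> is the remainder and \<open>R'\<close> its
      derivative.\<close>
    define R where "R t = H k t \<oplus> complex_of_real (- ((t - a) ^ Suc k) / real (Suc k)) \<odot> F \<oplus>
      complex_of_real (- ((t - a) ^ Suc (Suc k)) / real (Suc (Suc k))) \<odot> F'" for t
    define R' where "R' t = complex_of_real ((t - a) ^ k) \<odot> D (Suc k) t \<oplus>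
      complex_of_real (- ((t - a) ^ k)) \<odot> F \<oplus> complex_of_real (- ((t - a) ^ Suc k)) \<odot> F'" for t
    have "limitin (topol A) (\<lambda>h. complex_of_real (1 / h ^ Suc (Suc k)) \<odot> R (a + h)) \<zero> (at 0)"
    proof (rule limitin_derivative_quotient)
      show "R t \<in> carrier A" for t by (simp add: R_def Hc Fc smult_carrier)
      show "R a = \<zero>" by (simp add: R_def Ha Fc smult_0)
      show "R' a = \<zero>"
        \<comment> \<open>For \<open>k = 0\<close> the powers \<open>(t - a) ^ k\<close> are 1 and
          the first two terms cancel by the choice of \<open>F\<close>; otherwise every power
          vanishes at \<open>a\<close>.\<close>
        by (cases k) (simp_all add: R'_def Fc Dc smult_0 smult_1 smult_combine smult_carrier F_def
            flip: minus_smult a_inv_smult, simp add: ring.ring_simprules[OF ring_A] Dc)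
      show "has_lc_deriv A R t (R' t)" for t
      proof -
        have d: "((\<lambda>t. - ((t - a) ^ Suc j) / real (Suc j)) has_real_derivative - ((t - a) ^ j)) (at t)" for j
          using DERIV_cdivide[OF DERIV_minus[OF DERIV_diff_power_Suc[of a j t]], of "real (Suc j)"]
          by (simp del: of_nat_Suc)
        show ?thesis
          unfolding R_def R'_def
          by (intro has_lc_deriv_add has_lc_deriv_scale_const H_deriv d)
            (simp_all add: smult_carrier Hc Fc)
      qed
      \<comment> \<open>Divided by \<open>h ^ Suc k\<close>, \<open>R' (a + h)\<close> is the
        difference quotient of \<open>D (Suc k)\<close> at \<open>a\<close> minus its limit
        \<open>F'\<close>.\<close>
      have "limitin (topol A) (\<lambda>h. complex_of_real (1 / h) \<odot> (D (Suc k) (a + h) \<ominus> D (Suc k) a) \<oplus>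
          (- 1) \<odot> F') (F' \<oplus> (- 1) \<odot> F') (at 0)"
        using D[of "Suc k" a] unfolding has_lc_deriv_def
        by (intro limitin_add) (simp_all add: F'_def smult_carrier Dc topspace_topol)
      also have "F' \<oplus> (- 1) \<odot> F' = \<zero>"
        using Fc smult_combine(1)[of F' 1 "-1"] by (simp add: smult_1 smult_0)
      finally show "limitin (topol A) (\<lambda>h. complex_of_real (1 / h ^ Suc k) \<odot> R' (a + h)) \<zero> (at 0)"
      proof (rule limitin_transform_eventually[rotated])
        have "complex_of_real (1 / h) \<odot> (D (Suc k) (a + h) \<ominus> D (Suc k) a) \<oplus> (- 1) \<odot> F' =
          complex_of_real (1 / h ^ Suc k) \<odot> R' (a + h)" if "h \<noteq> 0" for h
        proof -
          have "complex_of_real (1 / h ^ Suc k) * complex_of_real (h ^ k) = complex_of_real (1 / h)"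
            "complex_of_real (1 / h ^ Suc k) * complex_of_real (- (h ^ k)) = complex_of_real (- (1 / h))"
            "complex_of_real (1 / h ^ Suc k) * complex_of_real (- (h ^ Suc k)) = - 1"
            "complex_of_real (1 / h) * - 1 = complex_of_real (- (1 / h))"
            unfolding of_real_mult[symmetric] using that by (simp_all add: flip: of_real_mult)
          then show ?thesis
            using Dc Fc by (simp only: R'_def F_def minus_smult smult_add smult_smult smult_carrier
                add_diff_cancel_left' ring.ring_simprules(1)[OF ring_A])
        qed
        then show "\<forall>\<^sub>F h in at 0. complex_of_real (1 / h) \<odot> (D (Suc k) (a + h) \<ominus> D (Suc k) a) \<oplus> (- 1) \<odot> F' =
          complex_of_real (1 / h ^ Suc k) \<odot> R' (a + h)"
          unfolding eventually_at by (auto intro!: exI[of _ 1])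
      qed
    qed
    \<comment> \<open>The subtracted \<open>F\<close> term supplies \<open>G k a\<close>, and the
      \<open>F'\<close> term supplies \<open>G (Suc k) a\<close>. So the remainder estimate says
      that the difference quotient of \<open>G k\<close> at \<open>a\<close> tends to
      \<open>G (Suc k) a\<close>.\<close>
    moreover have "complex_of_real (1 / h ^ Suc (Suc k)) \<odot> R (a + h) =
        complex_of_real (1 / h) \<odot> (G k (a + h) \<ominus> G k a) \<oplus>
        complex_of_real (- (1 / real (Suc (Suc k)))) \<odot> F'" if "h \<noteq> 0" for h
    proof -
      have "complex_of_real (1 / h) * complex_of_real (1 / h ^ Suc k) =
          complex_of_real (1 / h ^ Suc (Suc k))"
        "complex_of_real (1 / h) * (- 1 * complex_of_real (1 / real (Suc k))) =
          complex_of_real (- (1 / (h * real (Suc k))))"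
        "complex_of_real (1 / h ^ Suc (Suc k)) * complex_of_real (- (h ^ Suc k) / real (Suc k)) =
          complex_of_real (- (1 / (h * real (Suc k))))"
        "complex_of_real (1 / h ^ Suc (Suc k)) * complex_of_real (- (h ^ Suc (Suc k)) / real (Suc (Suc k))) =
          complex_of_real (- (1 / real (Suc (Suc k))))"
        using that by (simp_all add: field_simps del: of_nat_Suc)
      moreover have "a + h \<noteq> a" using that by simp
      ultimately show ?thesis
        using Hc Fc by (simp only: R_def G_def if_False if_True refl F_def[symmetric]
            minus_smult smult_add smult_smult smult_carrier add_diff_cancel_left'
            ring.ring_simprules(1)[OF ring_A])
    qed
    ultimately have "limitin (topol A) (\<lambda>h. complex_of_real (1 / h) \<odot> (G k (a + h) \<ominus> G k a) \<oplus>
        complex_of_real (- (1 / real (Suc (Suc k)))) \<odot> F') \<zero> (at 0)"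
      by (elim limitin_transform_eventually[rotated]) (auto simp: eventually_at intro!: exI[of _ 1])
    from limitin_add[OF this, of "\<lambda>_. G (Suc k) a" "G (Suc k) a"]
    have lim: "limitin (topol A) (\<lambda>h. (complex_of_real (1 / h) \<odot> (G k (a + h) \<ominus> G k a) \<oplus>
        complex_of_real (- (1 / real (Suc (Suc k)))) \<odot> F') \<oplus> G (Suc k) a) (\<zero> \<oplus> G (Suc k) a) (at 0)"
      by (simp add: topspace_topol Gc)
    have "(complex_of_real (1 / h) \<odot> (G k (a + h) \<ominus> G k a) \<oplus>
        complex_of_real (- (1 / real (Suc (Suc k)))) \<odot> F') \<oplus> G (Suc k) a =
        complex_of_real (1 / h) \<odot> (G k (a + h) \<ominus> G k a)" for h
    proof -
      have "complex_of_real (- (1 / real (Suc (Suc k)))) \<odot> F' \<oplus> G (Suc k) a = \<zero>"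
        using Fc by (simp only: G_def if_True refl F'_def[symmetric] smult_combine) (simp add: smult_0)
      moreover have "complex_of_real (1 / h) \<odot> (G k (a + h) \<ominus> G k a) \<in> carrier A"
        by (simp add: smult_carrier minus_smult Gc)
      ultimately show ?thesis
        using Fc Gc by (simp add: add_ac(1) smult_carrier)
    qed
    with lim show ?thesis unfolding has_lc_deriv_def True by (simp only: Gc ring.ring_simprules(8)[OF ring_A])
  qed
  have "G 0 \<in> smooth_curves A"
    unfolding smooth_curves_def using Gc G_deriv by blast
  moreover have "f t = complex_of_real (t - a) \<odot> G 0 t" for t
  proof (cases "t = a")
    case True
    then show ?thesis by (simp add: fa smult_0 Gc)
  next
    case False
    have "complex_of_real (t - a) * complex_of_real (1 / (t - a)) = 1"
      using False by (simp flip: of_real_mult)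
    then show ?thesis
      using False Dc[of 0] by (simp only: G_def if_False H0 D0 smult_smult power_Suc0_right One_nat_def smult_1)
  qed
  ultimately show thesis using that by blast
qed

section \<open>The algebra of smooth curves and its localization at 1\<close>

lemma ring_smooth_algebra: "ring (smooth_algebra A)"
proof (rule ringI)
  show "abelian_group (smooth_algebra A)"
  proof (rule abelian_groupI)
    fix f assume f: "f \<in> carrier (smooth_algebra A)"
    have "(- 1) \<odot> x \<oplus> x = \<zero>" if "x \<in> carrier A" for x
      using smult_combine(1)[OF that, of "- 1" 1] that by (simp add: smult_1 smult_0)
    then have "(\<lambda>t. (- 1) \<odot> f t) \<oplus>\<^bsub>smooth_algebra A\<^esub> f = \<zero>\<^bsub>smooth_algebra A\<^esub>"
      using f by (simp add: smooth_algebra_def smooth_curves_carrier)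
    moreover have "(\<lambda>t. (- 1) \<odot> f t) \<in> carrier (smooth_algebra A)"
      using f by (simp add: smooth_algebra_def smooth_curves_smult)
    ultimately show "\<exists>g\<in>carrier (smooth_algebra A). g \<oplus>\<^bsub>smooth_algebra A\<^esub> f = \<zero>\<^bsub>smooth_algebra A\<^esub>"
      by blast
  qed (simp_all add: smooth_algebra_def smooth_curves_add smooth_curves_const smooth_curves_carrier
      add_ac ring.ring_simprules(2,8)[OF ring_A])
  show "monoid (smooth_algebra A)"
    by (rule monoidI) (simp_all add: smooth_algebra_def smooth_curves_mult smooth_curves_const
        smooth_curves_carrier ring.ring_simprules(6,11,12)[OF ring_A]
        monoid.r_one[OF ring.is_monoid[OF ring_A]])
qed (simp_all add: smooth_algebra_def smooth_curves_carrier mult_add_distrib)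

section \<open>The topology on smooth curves: evaluation and constant curves\<close>

lemma smooth_curves_continuous:
  assumes "f \<in> smooth_curves A"
  shows "continuous_map euclideanreal (topol A) f"
  unfolding continuous_map_def
proof (intro conjI allI impI)
  show "f \<in> topspace euclideanreal \<rightarrow> topspace (topol A)"
    using assms by (auto simp: topspace_topol smooth_curves_carrier)
  fix U assume U: "openin (topol A) U"
  have "\<exists>e>0. \<forall>s. dist s t < e \<longrightarrow> f s \<in> U" if t: "f t \<in> U" for t
  proof -
    obtain l where "has_lc_deriv A f t l" using assms by (meson smooth_curves_deriv)
    then have "limitin (topol A) (\<lambda>h. f (t + h)) (f t) (at 0)"
      using smooth_curves_carrier[OF assms] by (rule has_lc_deriv_continuous[rotated])
    with U t have "\<forall>\<^sub>F h in at 0. f (t + h) \<in> U" by (blast dest: limitinD)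
    then obtain e where e: "e > 0" "\<And>h. h \<noteq> 0 \<Longrightarrow> \<bar>h\<bar> < e \<Longrightarrow> f (t + h) \<in> U"
      unfolding eventually_at by (auto simp: dist_real_def)
    have "f s \<in> U" if "dist s t < e" for s
      using e(2)[of "s - t"] t that by (cases "s = t") (auto simp: dist_real_def)
    with e(1) show ?thesis by blast
  qed
  then have "open {t. f t \<in> U}" unfolding open_dist by auto
  then show "openin euclideanreal {t \<in> topspace euclideanreal. f t \<in> U}" by simp
qed

lemma tangent_map_0_cont_maps:
  assumes "f \<in> smooth_curves A"
  shows "tangent_map A f 0 \<in>
    cont_maps (tangent_topology euclideanreal 0) (tangent_topology (topol A) 0)"
proof -
  have "continuous_map (product_topology (\<lambda>_. euclideanreal) {..<1}) (topol A) (\<lambda>w. f (w (0::nat)))"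
    using continuous_map_compose[OF
        continuous_map_product_projection[of 0 "{..<1::nat}" "\<lambda>_. euclideanreal"]
        smooth_curves_continuous[OF assms]]
    by (simp add: o_def)
  then show ?thesis
    unfolding cont_maps_def tangent_topology_def
    by (auto simp: tangent_topology_def continuous_map_componentwise
        intro: continuous_map_eq)
qed

text \<open>The space of a generated topology is the union of its generators. The generator of order
  0 with \<open>W\<close> the full function space contains every smooth curve, by continuity of
  these curves.\<close>

lemma topspace_smooth_topology: "topspace (smooth_topology A) = smooth_curves A"
proof
  show "topspace (smooth_topology A) \<subseteq> smooth_curves A"
    unfolding smooth_topology_def topology_generated_by_topspace by blast
  let ?W = "topspace (compact_open_topology (tangent_topology euclideanreal 0) (tangent_topology (topol A) 0))"
  show "smooth_curves A \<subseteq> topspace (smooth_topology A)"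
  proof
    fix f assume "f \<in> smooth_curves A"
    then have "f \<in> {f \<in> smooth_curves A. tangent_map A f 0 \<in> ?W}"
      using tangent_map_0_cont_maps by (simp add: topspace_compact_open_topology del: tangent_map.simps)
    moreover have "openin (smooth_topology A) {f \<in> smooth_curves A. tangent_map A f 0 \<in> ?W}"
      unfolding smooth_topology_def by (rule topology_generated_by_Basis) blast
    ultimately show "f \<in> topspace (smooth_topology A)"
      using openin_subset by blast
  qed
qed

text \<open>Points are compact, so requiring \<open>f a\<close> to lie in an open set is a subbasic
  condition of order 0, up to the encoding of points as functions on a one-element index
  set.\<close>

lemma continuous_map_eval: "continuous_map (smooth_topology A) (topol A) (\<lambda>f. f a)"
  unfolding continuous_map_def
proof (intro conjI allI impI)
  show "(\<lambda>f. f a) \<in> topspace (smooth_topology A) \<rightarrow> topspace (topol A)"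
    by (auto simp: topspace_smooth_topology topspace_topol smooth_curves_carrier)
  fix U assume U: "openin (topol A) U"
  let ?B = "tangent_topology euclideanreal 0" and ?Y = "tangent_topology (topol A) 0"
  define w where "w = (\<lambda>i\<in>{..<1::nat}. a)"
  define V where "V = {v \<in> topspace ?Y. v 0 \<in> U}"
  define W where "W = {F \<in> cont_maps ?B ?Y. F ` {w} \<subseteq> V}"
  have w: "w \<in> topspace ?B" by (simp add: w_def tangent_topology_def)
  have "openin ?Y V"
    unfolding V_def tangent_topology_def
    using openin_continuous_map_preimage[OF
        continuous_map_product_projection[of 0 "{..<2 ^ 0::nat}" "\<lambda>_. topol A"] U]
    by simp
  then have "openin (compact_open_topology ?B ?Y) W"
    unfolding compact_open_topology_def W_def using w
    by (intro topology_generated_by_Basis CollectI exI[of _ "{w}"] exI[of _ V]) simp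
  then have "openin (smooth_topology A) {f \<in> smooth_curves A. tangent_map A f 0 \<in> W}"
    unfolding smooth_topology_def by (intro topology_generated_by_Basis) blast
  moreover have "tangent_map A f 0 \<in> W \<longleftrightarrow> f a \<in> U" if f: "f \<in> smooth_curves A" for f
  proof -
    have eq: "tangent_map A f 0 w = (\<lambda>i\<in>{..<1}. f a)"
      using w by (simp add: w_def)
    have "tangent_map A f 0 w \<in> topspace ?Y"
      unfolding eq using f by (simp add: tangent_topology_def topspace_topol smooth_curves_carrier)
    then show ?thesis
      using tangent_map_0_cont_maps[OF f] eq
      by (simp add: W_def V_def del: tangent_map.simps)
  qed
  ultimately show "openin (smooth_topology A) {f \<in> topspace (smooth_topology A). f a \<in> U}"
    by (simp add: topspace_smooth_topology cong: conj_cong del: tangent_map.simps)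
qed

text \<open>The base point half of \<open>tangent_map\<close> repeats the previous order, and the
  tangent half differentiates a function constant in \<open>s\<close>; only component 0
  survives.\<close>

lemma tangent_map_const:
  assumes "x \<in> carrier A" "w \<in> topspace (tangent_topology euclideanreal k)"
  shows "tangent_map A (\<lambda>_. x) k w = (\<lambda>i\<in>{..<2 ^ k}. if i = 0 then x else \<zero>)"
  using assms(2)
proof (induction k arbitrary: w)
  case 0
  then show ?case by auto
next
  case (Suc k)
  \<comment> \<open>The induction hypothesis is applied at the base point and at all its translates
    along the tangent direction; every such restriction lies in its domain.\<close>
  have r: "restrict v {..<2 ^ k} \<in> topspace (tangent_topology euclideanreal k)" for v :: "nat \<Rightarrow> real"
    by (simp add: tangent_topology_def)
  have "lc_deriv A (\<lambda>_. y) 0 = \<zero>" if "y \<in> carrier A" for y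
    using that by (intro lc_deriv_eq has_lc_deriv_const)
  then show ?case
    using Suc.prems assms(1) by (auto simp: Suc.IH[OF r] fun_eq_iff)
qed

text \<open>By \<open>tangent_map_const\<close> the iterated tangent map of a constant curve takes a
  single value, which depends continuously on \<open>x\<close>. A condition on a compact set
  \<open>K\<close> thus becomes a condition on that value.\<close>

lemma continuous_map_const_curve: "continuous_map (topol A) (smooth_topology A) (\<lambda>x _. x)"
proof -
  have zero_vec: "continuous_map (topol A) (tangent_topology (topol A) k)
      (\<lambda>x. \<lambda>i\<in>{..<2 ^ k}. if i = 0 then x else \<zero>)" for k
  proof -
    have "continuous_map (topol A) (topol A) (\<lambda>x. if i = 0 then x else \<zero>)" for i :: nat
      by (cases "i = 0") (simp_all add: topspace_topol)
    then show ?thesis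
      unfolding tangent_topology_def continuous_map_componentwise by auto
  qed
  have cont: "tangent_map A (\<lambda>_. x) k \<in>
      cont_maps (tangent_topology euclideanreal k) (tangent_topology (topol A) k)"
    if "x \<in> carrier A" for x k
  proof -
    have "(\<lambda>i\<in>{..<2 ^ k}. if i = 0 then x else \<zero>) \<in> topspace (tangent_topology (topol A) k)"
      using zero_vec[of k] that by (auto simp: continuous_map_def topspace_topol)
    then have "continuous_map (tangent_topology euclideanreal k) (tangent_topology (topol A) k)
        (\<lambda>_. \<lambda>i\<in>{..<2 ^ k}. if i = 0 then x else \<zero>)"
      by simp
    then have "continuous_map (tangent_topology euclideanreal k) (tangent_topology (topol A) k)
        (tangent_map A (\<lambda>_. x) k)"
      by (rule continuous_map_eq) (simp add: tangent_map_const[OF that])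
    moreover have "tangent_map A (\<lambda>_. x) k \<in> extensional (topspace (tangent_topology euclideanreal k))"
      by (cases k) simp_all
    ultimately show ?thesis by (simp add: cont_maps_def)
  qed
  have *: "continuous_map (topol A)
      (compact_open_topology (tangent_topology euclideanreal k) (tangent_topology (topol A) k))
      (\<lambda>x. tangent_map A (\<lambda>_. x) k)" for k
    unfolding compact_open_topology_def
  proof (rule continuous_on_generated_topo)
    let ?B = "tangent_topology euclideanreal k" and ?Y = "tangent_topology (topol A) k"
    show "(\<lambda>x. tangent_map A (\<lambda>_. x) k) ` topspace (topol A)
        \<subseteq> \<Union> {{f \<in> cont_maps ?B ?Y. f ` K \<subseteq> U} |K U. compactin ?B K \<and> openin ?Y U}"
      using cont topspace_compact_open_topology[of ?B ?Y]
      unfolding compact_open_topology_def topology_generated_by_topspace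
      by (auto simp: topspace_topol)
    fix S assume "S \<in> {{f \<in> cont_maps ?B ?Y. f ` K \<subseteq> U} |K U. compactin ?B K \<and> openin ?Y U}"
    then obtain K U where S: "S = {f \<in> cont_maps ?B ?Y. f ` K \<subseteq> U}"
      and K: "compactin ?B K" and U: "openin ?Y U" by blast
    have sub: "K \<subseteq> topspace ?B" using K by (rule compactin_subset_topspace)
    \<comment> \<open>For empty \<open>K\<close> the condition is void and every \<open>x\<close>
      satisfies it, whether or not the value lies in \<open>U\<close>.\<close>
    have "(\<lambda>x. tangent_map A (\<lambda>_. x) k) -` S \<inter> topspace (topol A) =
        (if K = {} then topspace (topol A)
         else {x \<in> topspace (topol A). (\<lambda>i\<in>{..<2 ^ k}. if i = 0 then x else \<zero>) \<in> U})"
      using sub tangent_map_const cont by (auto simp: S topspace_topol image_subset_iff subset_iff)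
    then show "openin (topol A) ((\<lambda>x. tangent_map A (\<lambda>_. x) k) -` S \<inter> topspace (topol A))"
      using openin_continuous_map_preimage[OF zero_vec U] by simp
  qed
  show ?thesis
    unfolding smooth_topology_def
  proof (rule continuous_on_generated_topo)
    show "(\<lambda>x _. x) ` topspace (topol A)
        \<subseteq> \<Union> {{f \<in> smooth_curves A. tangent_map A f k \<in> W} |k W.
          openin (compact_open_topology (tangent_topology euclideanreal k) (tangent_topology (topol A) k)) W}"
      using smooth_curves_const topspace_smooth_topology
      unfolding smooth_topology_def topology_generated_by_topspace
      by (auto simp: topspace_topol)
    fix S assume "S \<in> {{f \<in> smooth_curves A. tangent_map A f k \<in> W} |k W.
          openin (compact_open_topology (tangent_topology euclideanreal k) (tangent_topology (topol A) k)) W}"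
    then obtain k W where S: "S = {f \<in> smooth_curves A. tangent_map A f k \<in> W}"
      and W: "openin (compact_open_topology (tangent_topology euclideanreal k) (tangent_topology (topol A) k)) W"
      by blast
    have "(\<lambda>x _. x) -` S \<inter> topspace (topol A) =
        {x \<in> topspace (topol A). tangent_map A (\<lambda>_. x) k \<in> W}"
      using smooth_curves_const by (auto simp: S topspace_topol)
    then show "openin (topol A) ((\<lambda>x _. x) -` S \<inter> topspace (topol A))"
      using openin_continuous_map_preimage[OF * W] by simp
  qed
qed

section \<open>Fibres of evaluation at 1, which turn out to be the elements of the
  localization\<close>

definition fibre :: "'a \<Rightarrow> (real \<Rightarrow> 'a) set" where
  "fibre x = {f \<in> smooth_curves A. f 1 = x}"

lemma const_mem_fibre: "x \<in> carrier A \<Longrightarrow> (\<lambda>_. x) \<in> fibre x"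
  by (simp add: fibre_def smooth_curves_const)

lemma fibre_carrier: "f \<in> fibre x \<Longrightarrow> x \<in> carrier A"
  by (auto simp: fibre_def smooth_curves_carrier)

lemma inj_on_fibre: "inj_on fibre (carrier A)"
proof (rule inj_onI)
  fix x y assume "x \<in> carrier A" "fibre x = fibre y"
  then have "(\<lambda>_. x) \<in> fibre y" using const_mem_fibre by blast
  then show "x = y" by (simp add: fibre_def)
qed

lemma ideal_fibre_zero: "ideal (fibre \<zero>) (smooth_algebra A)"
proof -
  have "ring_hom_ring (smooth_algebra A) A (\<lambda>f. f 1)"
    by (rule ring_hom_ringI[OF ring_smooth_algebra ring_A])
      (simp_all add: smooth_algebra_def smooth_curves_carrier)
  from ring_hom_ring.kernel_is_ideal[OF this] show ?thesis
    by (simp add: a_kernel_def' fibre_def smooth_algebra_def)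
qed

text \<open>The generator vanishes at 1 and \<open>fibre \<zero>\<close> is a closed ideal, being
  the kernel of a continuous homomorphism; this bounds the closure from above. By Hadamard's lemma
  \<open>fibre \<zero>\<close> already lies in the ideal before closure.\<close>

lemma loc_ideal_one: "loc_ideal A \<one> = fibre \<zero>"
proof
  let ?S = "smooth_algebra A" and ?g = "\<lambda>t. \<one> \<ominus> complex_of_real t \<odot> \<one>"
  have S: "carrier ?S = smooth_curves A" "topol ?S = smooth_topology A"
    by (simp_all add: smooth_algebra_def)
  have one: "\<one> \<in> carrier A" by (rule ring.ring_simprules(6)[OF ring_A])
  have g: "?g \<in> smooth_curves A"
    unfolding minus_smult[OF one smult_carrier[OF one]]
    by (intro smooth_curves_add smooth_curves_const smooth_curves_smult smooth_curves_real_smult one)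
  have "?g \<in> fibre \<zero>"
    using g one by (simp add: fibre_def smult_1 ring.ring_simprules[OF ring_A])
  then have "Idl\<^bsub>?S\<^esub> {?g} \<subseteq> fibre \<zero>"
    by (intro ring.genideal_minimal[OF ring_smooth_algebra ideal_fibre_zero]) simp
  moreover have "closedin (smooth_topology A) (fibre \<zero>)"
  proof -
    have "closedin (topol A) {\<zero>}"
      using Hausdorff by (simp add: closedin_Hausdorff_sing_eq topspace_topol)
    from closedin_continuous_map_preimage[OF continuous_map_eval this, of 1] show ?thesis
      by (simp add: fibre_def topspace_smooth_topology)
  qed
  ultimately show "loc_ideal A \<one> \<subseteq> fibre \<zero>"
    unfolding loc_ideal_def S by (rule closure_of_minimal)
  have ideal: "ideal (Idl\<^bsub>?S\<^esub> {?g}) ?S"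
    using ring.genideal_ideal[OF ring_smooth_algebra, of "{?g}"] g by (simp add: S)
  have "Idl\<^bsub>?S\<^esub> {?g} \<subseteq> smooth_curves A"
    using ideal.Icarr[OF ideal] by (auto simp: S)
  then have "Idl\<^bsub>?S\<^esub> {?g} \<subseteq> loc_ideal A \<one>"
    unfolding loc_ideal_def S by (intro closure_of_subset) (simp add: topspace_smooth_topology)
  moreover have "fibre \<zero> \<subseteq> Idl\<^bsub>?S\<^esub> {?g}"
  proof
    fix f assume f: "f \<in> fibre \<zero>"
    then obtain q where q: "q \<in> smooth_curves A" "\<And>t. f t = complex_of_real (t - 1) \<odot> q t"
      using smooth_curves_divide[of f 1] unfolding fibre_def by blast
    \<comment> \<open>The generator is \<open>1 - t\<close>, while the division extracts
      \<open>t - 1\<close>; hence the sign in the cofactor.\<close>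
    have "f t = ?g t \<otimes> ((- 1) \<odot> q t)" for t
    proof -
      have qt: "q t \<in> carrier A" using q(1) by (rule smooth_curves_carrier)
      have "?g t \<otimes> ((- 1) \<odot> q t) = (- 1) \<odot> q t \<oplus> complex_of_real t \<odot> q t"
        using one qt by (simp add: minus_smult smult_add smult_carrier mult_add_distrib smult_mult_left
            smult_mult_right smult_smult ring.ring_simprules(12)[OF ring_A])
      then show ?thesis using qt by (simp add: q(2) smult_combine)
    qed
    then have "f = ?g \<otimes>\<^bsub>?S\<^esub> (\<lambda>t. (- 1) \<odot> q t)" by (auto simp: smooth_algebra_def)
    moreover have "?g \<in> Idl\<^bsub>?S\<^esub> {?g}"
      using ring.genideal_self[OF ring_smooth_algebra, of "{?g}"] g by (simp add: S)
    moreover have "(\<lambda>t. (- 1) \<odot> q t) \<in> carrier ?S" using q(1) by (simp add: S smooth_curves_smult)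
    ultimately show "f \<in> Idl\<^bsub>?S\<^esub> {?g}" using ideal.I_r_closed[OF ideal] by metis
  qed
  ultimately show "fibre \<zero> \<subseteq> loc_ideal A \<one>" by blast
qed

lemma diff_mem_fibre_zero:
  assumes "f \<in> fibre x" "g \<in> fibre x"
  shows "(\<lambda>t. f t \<oplus> (- 1) \<odot> g t) \<in> fibre \<zero>"
    and "(\<lambda>t. (f t \<oplus> (- 1) \<odot> g t) \<oplus> g t) = f"
proof -
  have c: "f t \<in> carrier A" "g t \<in> carrier A" for t
    using assms by (auto simp: fibre_def smooth_curves_carrier)
  have z: "(- 1) \<odot> y \<oplus> y = \<zero>" if "y \<in> carrier A" for y
    using smult_combine(1)[OF that, of "- 1" 1] that by (simp add: smult_1 smult_0)
  have x: "x \<in> carrier A" using assms(1) by (rule fibre_carrier)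
  show "(\<lambda>t. f t \<oplus> (- 1) \<odot> g t) \<in> fibre \<zero>"
    using assms z[OF x] x
    by (auto simp: fibre_def add_ac(2) smult_carrier intro!: smooth_curves_add smooth_curves_smult)
  show "(\<lambda>t. (f t \<oplus> (- 1) \<odot> g t) \<oplus> g t) = f"
    using c by (simp add: add_ac(1) smult_carrier z ring.ring_simprules(15)[OF ring_A])
qed

text \<open>The product, scalar multiples and action on the localization are unions of cosets of
  representatives. Once each coset is a fibre, only a value at 1 remains to be computed.\<close>

lemma coset_fibre_zero:
  assumes "f \<in> fibre x"
  shows "fibre \<zero> +>\<^bsub>smooth_algebra A\<^esub> f = fibre x"
proof
  show "fibre \<zero> +>\<^bsub>smooth_algebra A\<^esub> f \<subseteq> fibre x"
    using assms fibre_carrier[OF assms]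
    by (auto simp: a_r_coset_def' fibre_def smooth_algebra_def smooth_curves_add
        ring.ring_simprules(8)[OF ring_A])
  show "fibre x \<subseteq> fibre \<zero> +>\<^bsub>smooth_algebra A\<^esub> f"
  proof
    fix g assume "g \<in> fibre x"
    from diff_mem_fibre_zero[OF this assms] show "g \<in> fibre \<zero> +>\<^bsub>smooth_algebra A\<^esub> f"
      unfolding a_r_coset_def' by (auto simp: smooth_algebra_def intro!: bexI[of _ "\<lambda>t. g t \<oplus> (- 1) \<odot> f t"])
  qed
qed

lemma carrier_localization_one: "carrier (localization A \<one>) = fibre ` carrier A"
proof -
  have "carrier (localization A \<one>) = (\<lambda>f. fibre \<zero> +>\<^bsub>smooth_algebra A\<^esub> f) ` smooth_curves A"
    by (auto simp: localization_def quotient_algebra_def FactRing_def A_RCOSETS_def' loc_ideal_one)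
      (auto simp: smooth_algebra_def)
  also have "\<dots> = (\<lambda>f. fibre (f 1)) ` smooth_curves A"
    by (intro image_cong coset_fibre_zero) (simp_all add: fibre_def)
  also have "\<dots> = fibre ` carrier A"
    using smooth_curves_const by (force simp: smooth_curves_carrier)
  finally show ?thesis .
qed

lemma one_localization_one: "\<one>\<^bsub>localization A \<one>\<^esub> = fibre \<one>"
proof -
  have "\<one>\<^bsub>smooth_algebra A\<^esub> \<in> fibre \<one>"
    using const_mem_fibre ring.ring_simprules(6)[OF ring_A] by (simp add: smooth_algebra_def)
  then show ?thesis
    by (simp add: localization_def quotient_algebra_def FactRing_def loc_ideal_one coset_fibre_zero)
qed

lemma zero_localization_one: "\<zero>\<^bsub>localization A \<one>\<^esub> = fibre \<zero>"
  by (simp add: localization_def quotient_algebra_def FactRing_def loc_ideal_one)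

text \<open>All members of the union in \<open>rcoset_mult\<close> coincide, and constant curves
  show that the union is not empty.\<close>

lemma mult_localization_one:
  assumes "x \<in> carrier A" "y \<in> carrier A"
  shows "fibre x \<otimes>\<^bsub>localization A \<one>\<^esub> fibre y = fibre (x \<otimes> y)"
proof -
  have "fibre \<zero> +>\<^bsub>smooth_algebra A\<^esub> (f \<otimes>\<^bsub>smooth_algebra A\<^esub> g) = fibre (x \<otimes> y)"
    if "f \<in> fibre x" "g \<in> fibre y" for f g
    using that by (intro coset_fibre_zero) (auto simp: fibre_def smooth_algebra_def smooth_curves_mult)
  then show ?thesis
    using const_mem_fibre assms
    by (force simp: localization_def quotient_algebra_def FactRing_def rcoset_mult_def loc_ideal_one)
qed

text \<open>Addition of cosets is the elementwise sum of sets, so each curve \<open>f\<close> over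
  the sum of \<open>x\<close> and \<open>y\<close> has to be split: into \<open>f\<close> minus
  \<open>y\<close>, which lies over \<open>x\<close>, and the constant curve
  \<open>y\<close>.\<close>

lemma add_localization_one:
  assumes "x \<in> carrier A" "y \<in> carrier A"
  shows "fibre x \<oplus>\<^bsub>localization A \<one>\<^esub> fibre y = fibre (x \<oplus> y)"
proof -
  have "fibre x <+>\<^bsub>smooth_algebra A\<^esub> fibre y = fibre (x \<oplus> y)"
  proof
    show "fibre x <+>\<^bsub>smooth_algebra A\<^esub> fibre y \<subseteq> fibre (x \<oplus> y)"
      by (auto simp: set_add_def' fibre_def smooth_algebra_def smooth_curves_add)
    show "fibre (x \<oplus> y) \<subseteq> fibre x <+>\<^bsub>smooth_algebra A\<^esub> fibre y"
    proof
      fix f assume f: "f \<in> fibre (x \<oplus> y)"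
      have c: "f t \<in> carrier A" for t using f by (simp add: fibre_def smooth_curves_carrier)
      have z: "(- 1) \<odot> u \<oplus> u = \<zero>" "u \<oplus> (- 1) \<odot> u = \<zero>" if "u \<in> carrier A" for u
        using smult_combine(1)[OF that, of "- 1" 1] that by (simp_all add: smult_1 smult_0 add_ac(2) smult_carrier)
      have "f = (\<lambda>t. (f t \<oplus> (- 1) \<odot> y) \<oplus> y)"
        using c assms by (simp add: add_ac(1) smult_carrier z ring.ring_simprules(15)[OF ring_A])
      then have "f = (\<lambda>t. f t \<oplus> (- 1) \<odot> y) \<oplus>\<^bsub>smooth_algebra A\<^esub> (\<lambda>_. y)"
        by (simp add: smooth_algebra_def)
      moreover have "(\<lambda>t. f t \<oplus> (- 1) \<odot> y) \<in> fibre x"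
        using f assms
        by (auto simp: fibre_def add_ac(1) smult_carrier z ring.ring_simprules(15)[OF ring_A]
            intro!: smooth_curves_add smooth_curves_const)
      ultimately show "f \<in> fibre x <+>\<^bsub>smooth_algebra A\<^esub> fibre y"
        unfolding set_add_def' using const_mem_fibre[OF assms(2)] by blast
    qed
  qed
  then show ?thesis by (simp add: localization_def quotient_algebra_def FactRing_def)
qed

lemma smult_localization_one:
  assumes "x \<in> carrier A"
  shows "c \<odot>\<^bsub>localization A \<one>\<^esub> fibre x = fibre (c \<odot> x)"
proof -
  have "fibre \<zero> +>\<^bsub>smooth_algebra A\<^esub> (c \<odot>\<^bsub>smooth_algebra A\<^esub> f) = fibre (c \<odot> x)"
    if "f \<in> fibre x" for f
    using that by (intro coset_fibre_zero) (auto simp: fibre_def smooth_algebra_def smooth_curves_smult)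
  then show ?thesis
    using const_mem_fibre assms
    by (force simp: localization_def quotient_algebra_def loc_ideal_one)
qed

lemma homeomorphic_map_fibre: "homeomorphic_map (topol A) (topol (localization A \<one>)) fibre"
proof (rule bijective_open_imp_homeomorphic_map)
  have "{f \<in> smooth_curves A. fibre \<zero> +>\<^bsub>smooth_algebra A\<^esub> f \<in> U} =
      {f \<in> smooth_curves A. fibre (f 1) \<in> U}" for U
    using coset_fibre_zero by (auto simp: fibre_def)
  moreover have "(\<lambda>f. fibre \<zero> +>\<^bsub>smooth_algebra A\<^esub> f) ` smooth_curves A = fibre ` carrier A"
    unfolding carrier_localization_one[symmetric]
    by (auto simp: localization_def quotient_algebra_def FactRing_def A_RCOSETS_def' loc_ideal_one)
      (auto simp: smooth_algebra_def)
  ultimately have openin: "openin (topol (localization A \<one>)) U \<longleftrightarrow>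
      U \<subseteq> fibre ` carrier A \<and> openin (smooth_topology A) {f \<in> smooth_curves A. fibre (f 1) \<in> U}" for U
    by (simp add: localization_def quotient_algebra_def openin_quotient_topology loc_ideal_one)
      (simp add: smooth_algebra_def topspace_smooth_topology)
  \<comment> \<open>The set of all fibres is open, since its preimage consists of all smooth curves;
    this identifies the space of the quotient topology.\<close>
  have "{f \<in> smooth_curves A. fibre (f 1) \<in> fibre ` carrier A} = topspace (smooth_topology A)"
    by (auto simp: topspace_smooth_topology smooth_curves_carrier)
  then have "openin (topol (localization A \<one>)) (fibre ` carrier A)"
    by (simp only: openin openin_topspace subset_refl simp_thms)
  moreover have "topspace (topol (localization A \<one>)) \<subseteq> fibre ` carrier A"
    using openin openin_topspace by blast
  ultimately have top: "topspace (topol (localization A \<one>)) = fibre ` carrier A"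
    by (intro equalityI openin_subset)
  then show "fibre ` topspace (topol A) = topspace (topol (localization A \<one>))"
    by (simp add: topspace_topol)
  show "inj_on fibre (topspace (topol A))" by (simp add: topspace_topol inj_on_fibre)
  show "continuous_map (topol A) (topol (localization A \<one>)) fibre"
    unfolding continuous_map_def
  proof (intro conjI allI impI)
    show "fibre \<in> topspace (topol A) \<rightarrow> topspace (topol (localization A \<one>))"
      by (simp add: top topspace_topol)
    fix U assume "openin (topol (localization A \<one>)) U"
    then have "openin (smooth_topology A) {f \<in> smooth_curves A. fibre (f 1) \<in> U}" by (simp add: openin)
    from openin_continuous_map_preimage[OF continuous_map_const_curve this]
    show "openin (topol A) {x \<in> topspace (topol A). fibre x \<in> U}"
      by (simp add: topspace_topol smooth_curves_const cong: conj_cong)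
  qed
  show "open_map (topol A) (topol (localization A \<one>)) fibre"
    unfolding open_map_def
  proof (intro allI impI)
    fix U assume U: "openin (topol A) U"
    then have sub: "U \<subseteq> carrier A" using openin_subset topspace_topol by metis
    \<comment> \<open>Injectivity of \<open>fibre\<close> reduces the preimage to a condition on
      \<open>f 1\<close>, which is open by continuity of the evaluation.\<close>
    have "{f \<in> smooth_curves A. fibre (f 1) \<in> fibre ` U} = {f \<in> smooth_curves A. f 1 \<in> U}"
      using inj_on_image_mem_iff[OF inj_on_fibre _ sub] smooth_curves_carrier by blast
    then show "openin (topol (localization A \<one>)) (fibre ` U)"
      using openin_continuous_map_preimage[OF continuous_map_eval U, of 1] sub
      by (auto simp: openin topspace_smooth_topology)
  qed
qed

text \<open>Composition with a continuous linear map preserves smoothness and commutes with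
  evaluation, so every representative of \<open>fibre x\<close> is sent into the same fibre.\<close>

lemma loc_action_one:
  assumes "\<alpha> g \<in> lc_auto A" "x \<in> carrier A"
  shows "loc_action A \<alpha> \<one> g (fibre x) = fibre (\<alpha> g x)"
proof -
  have "fibre \<zero> +>\<^bsub>smooth_algebra A\<^esub> (\<alpha> g \<circ> f) = fibre (\<alpha> g x)" if "f \<in> fibre x" for f
  proof (rule coset_fibre_zero)
    have "continuous_map (topol A) (topol A) (\<alpha> g)"
      using assms(1) by (simp add: lc_auto_def homeomorphic_imp_continuous_map)
    moreover have "\<alpha> g (x \<oplus> y) = \<alpha> g x \<oplus> \<alpha> g y" if "x \<in> carrier A" "y \<in> carrier A" for x y
      using assms(1) that by (simp add: lc_auto_def ring_iso_def ring_hom_add)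
    moreover have "\<alpha> g (c \<odot> x) = c \<odot> \<alpha> g x" if "x \<in> carrier A" for c x
      using assms(1) that by (simp add: lc_auto_def)
    moreover have "f \<in> smooth_curves A" using that by (simp add: fibre_def)
    ultimately have "(\<lambda>t. \<alpha> g (f t)) \<in> smooth_curves A"
      by (rule smooth_curves_linear)
    then show "\<alpha> g \<circ> f \<in> fibre (\<alpha> g x)" using that by (simp add: fibre_def o_def)
  qed
  then have "(\<Union>f\<in>fibre x. fibre \<zero> +>\<^bsub>smooth_algebra A\<^esub> (\<alpha> g \<circ> f)) = fibre (\<alpha> g x)"
    using const_mem_fibre[OF assms(2)] by (intro SUP_eq_const) auto
  then show ?thesis
    using assms(2) by (simp add: loc_action_def carrier_localization_one loc_ideal_one)
qed

end

section \<open>Transport along an isomorphism\<close>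

text \<open>The product of \<open>BijGroup\<close> is \<open>compose\<close> only for arguments in
  \<open>Bij\<close>, so this membership is what lets products in \<open>lc_Aut\<close> be
  unfolded.\<close>

lemma lc_auto_Bij: "f \<in> lc_auto R \<Longrightarrow> f \<in> Bij (carrier R)"
  by (auto simp: lc_auto_def ring_iso_def Bij_def)

text \<open>\<open>B\<close> is only a record here; that it is a locally convex algebra is a
  conclusion. The equations are oriented so that rewriting pulls all operations of \<open>B\<close>
  back to \<open>A\<close> under one \<open>E\<close>.\<close>

locale lc_algebra_iso = A: lc_algebra A
  for A :: "'a top_algebra" and B :: "'b top_algebra" and E :: "'a \<Rightarrow> 'b" and D :: "'b \<Rightarrow> 'a" +
  assumes carrier_B: "carrier B = E ` carrier A"
    and E_add: "\<lbrakk>x \<in> carrier A; y \<in> carrier A\<rbrakk> \<Longrightarrow> E x \<oplus>\<^bsub>B\<^esub> E y = E (x \<oplus>\<^bsub>A\<^esub> y)"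
    and E_mult: "\<lbrakk>x \<in> carrier A; y \<in> carrier A\<rbrakk> \<Longrightarrow> E x \<otimes>\<^bsub>B\<^esub> E y = E (x \<otimes>\<^bsub>A\<^esub> y)"
    and E_smult: "x \<in> carrier A \<Longrightarrow> c \<odot>\<^bsub>B\<^esub> E x = E (c \<odot>\<^bsub>A\<^esub> x)"
    and E_one: "\<one>\<^bsub>B\<^esub> = E \<one>\<^bsub>A\<^esub>"
    and E_zero: "\<zero>\<^bsub>B\<^esub> = E \<zero>\<^bsub>A\<^esub>"
    and homeo: "homeomorphic_maps (topol A) (topol B) E D"
begin

lemma continuous_E: "continuous_map (topol A) (topol B) E"
  and continuous_D: "continuous_map (topol B) (topol A) D"
  and DE: "x \<in> carrier A \<Longrightarrow> D (E x) = x"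
  using homeo by (simp_all add: homeomorphic_maps_def A.topspace_topol)

lemma topspace_B: "topspace (topol B) = carrier B"
  using homeomorphic_imp_surjective_map[OF homeomorphic_maps_imp_map[OF homeo]]
  by (simp add: carrier_B A.topspace_topol)

lemma ring_B: "ring B"
proof (rule ringI)
  note A = ring.ring_simprules[OF A.ring_A]
  show "abelian_group B"
  proof (rule abelian_groupI)
    fix y assume "y \<in> carrier B"
    then obtain x where x: "x \<in> carrier A" "y = E x" by (auto simp: carrier_B)
    then have "E (\<ominus>\<^bsub>A\<^esub> x) \<oplus>\<^bsub>B\<^esub> y = \<zero>\<^bsub>B\<^esub>"
      by (simp add: E_add E_zero A(3,9))
    with x show "\<exists>z\<in>carrier B. z \<oplus>\<^bsub>B\<^esub> y = \<zero>\<^bsub>B\<^esub>"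
      by (auto simp: carrier_B A(3))
  qed (auto simp: carrier_B E_add E_zero A(1,2,7,8,10,22))
  show "monoid B"
    by (rule monoidI)
      (auto simp: carrier_B E_mult E_one A(5,6,11,12) monoid.r_one[OF ring.is_monoid[OF A.ring_A]])
qed (auto simp: carrier_B E_mult E_add ring.ring_simprules(1,5,13,23)[OF A.ring_A])

lemma module_B: "module complex_ring B"
proof (rule moduleI)
  show "cring complex_ring" ..
  show "abelian_group B" using ring_B by (rule ring.is_abelian_group)
qed (auto simp: carrier_B E_smult E_add A.smult_carrier ring.ring_simprules(1)[OF A.ring_A]
    A.smult_l_distr A.smult_r_distr A.smult_assoc1)

text \<open>On the carrier each operation of \<open>B\<close> is that of \<open>A\<close> conjugated
  by \<open>E\<close> and \<open>D\<close>, hence continuous as a composition. Convex neighbourhoods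
  of zero are images under the open linear map \<open>E\<close>.\<close>

lemma lc_algebra_B: "lc_algebra B"
proof (intro lc_algebra.intro ring_B module_B lc_algebra_axioms.intro)
  note A = ring.ring_simprules[OF A.ring_A]
  show "topspace (topol B) = carrier B" by (rule topspace_B)
  show "Hausdorff_space (topol B)"
    using A.Hausdorff homeo homeomorphic_Hausdorff_space
    by (metis homeomorphic_maps_imp_homeomorphic_space)
  have D_fst: "continuous_map (prod_topology (topol B) (topol B)) (prod_topology (topol A) (topol A))
      (\<lambda>(x, y). (D x, D y))"
    using continuous_D by (simp add: continuous_map_prod_top)
  show "continuous_map (prod_topology (topol B) (topol B)) (topol B) (\<lambda>(x, y). x \<oplus>\<^bsub>B\<^esub> y)"
  proof (rule continuous_map_eq)
    show "continuous_map (prod_topology (topol B) (topol B)) (topol B)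
        (E \<circ> ((\<lambda>(x, y). x \<oplus>\<^bsub>A\<^esub> y) \<circ> (\<lambda>(x, y). (D x, D y))))"
      by (intro continuous_map_compose[OF _ continuous_E] continuous_map_compose[OF D_fst A.continuous_add])
  qed (auto simp: topspace_B carrier_B E_add DE)
  show "continuous_map (prod_topology (topol B) (topol B)) (topol B) (\<lambda>(x, y). x \<otimes>\<^bsub>B\<^esub> y)"
  proof (rule continuous_map_eq)
    show "continuous_map (prod_topology (topol B) (topol B)) (topol B)
        (E \<circ> ((\<lambda>(x, y). x \<otimes>\<^bsub>A\<^esub> y) \<circ> (\<lambda>(x, y). (D x, D y))))"
      by (intro continuous_map_compose[OF _ continuous_E] continuous_map_compose[OF D_fst A.continuous_mult])
  qed (auto simp: topspace_B carrier_B E_mult DE)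
  have D_snd: "continuous_map (prod_topology euclidean (topol B)) (prod_topology euclidean (topol A))
      (\<lambda>(c, y). (c, D y))"
    using continuous_D by (simp add: continuous_map_prod_top)
  show "continuous_map (prod_topology euclidean (topol B)) (topol B) (\<lambda>(c, x). c \<odot>\<^bsub>B\<^esub> x)"
  proof (rule continuous_map_eq)
    show "continuous_map (prod_topology euclidean (topol B)) (topol B)
        (E \<circ> ((\<lambda>(c, y). c \<odot>\<^bsub>A\<^esub> y) \<circ> (\<lambda>(c, y). (c, D y))))"
      by (intro continuous_map_compose[OF _ continuous_E] continuous_map_compose[OF D_snd A.continuous_smult])
  qed (auto simp: topspace_B carrier_B E_smult DE)
  fix U assume U: "openin (topol B) U" "\<zero>\<^bsub>B\<^esub> \<in> U"
  let ?U = "{x \<in> topspace (topol A). E x \<in> U}"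
  have "openin (topol A) ?U" using U(1) by (rule openin_continuous_map_preimage[OF continuous_E])
  note U_open = this
  have "\<zero>\<^bsub>A\<^esub> \<in> ?U" using U(2) A(2) by (simp add: E_zero A.topspace_topol)
  note U_zero = this
  obtain V where V: "openin (topol A) V" "\<zero>\<^bsub>A\<^esub> \<in> V" "V \<subseteq> ?U"
    and convex: "\<forall>x\<in>V. \<forall>y\<in>V. \<forall>s::real. 0 \<le> s \<and> s \<le> 1 \<longrightarrow>
      complex_of_real s \<odot>\<^bsub>A\<^esub> x \<oplus>\<^bsub>A\<^esub> complex_of_real (1 - s) \<odot>\<^bsub>A\<^esub> y \<in> V"
    using A.locally_convex[OF U_open U_zero] by (elim exE conjE) (rule that; assumption)
  have sub: "V \<subseteq> carrier A" using V(1) openin_subset A.topspace_topol by metis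
  have "openin (topol B) (E ` V)"
    using homeomorphic_map_openness_eq[OF homeomorphic_maps_imp_map[OF homeo], of V] V(1) by blast
  moreover have "complex_of_real s \<odot>\<^bsub>B\<^esub> E x \<oplus>\<^bsub>B\<^esub> complex_of_real (1 - s) \<odot>\<^bsub>B\<^esub> E y \<in> E ` V"
    if "x \<in> V" "y \<in> V" "0 \<le> s" "s \<le> 1" for x y and s :: real
  proof -
    have "complex_of_real s \<odot>\<^bsub>B\<^esub> E x \<oplus>\<^bsub>B\<^esub> complex_of_real (1 - s) \<odot>\<^bsub>B\<^esub> E y =
        E (complex_of_real s \<odot>\<^bsub>A\<^esub> x \<oplus>\<^bsub>A\<^esub> complex_of_real (1 - s) \<odot>\<^bsub>A\<^esub> y)"
      using that(1,2) sub by (simp add: E_smult E_add A.smult_carrier subset_iff del: of_real_diff)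
    also have "\<dots> \<in> E ` V" using convex that by blast
    finally show ?thesis .
  qed
  ultimately show "\<exists>V. openin (topol B) V \<and> \<zero>\<^bsub>B\<^esub> \<in> V \<and> V \<subseteq> U \<and>
      (\<forall>x\<in>V. \<forall>y\<in>V. \<forall>s::real. 0 \<le> s \<and> s \<le> 1 \<longrightarrow>
        complex_of_real s \<odot>\<^bsub>B\<^esub> x \<oplus>\<^bsub>B\<^esub> complex_of_real (1 - s) \<odot>\<^bsub>B\<^esub> y \<in> V)"
    using V(2,3) E_zero by (intro exI[of _ "E ` V"]) (auto simp del: of_real_diff)
next
  note A = ring.ring_simprules[OF A.ring_A]
  fix c x y assume "x \<in> carrier B" "y \<in> carrier B"
  then show "c \<odot>\<^bsub>B\<^esub> x \<otimes>\<^bsub>B\<^esub> y = c \<odot>\<^bsub>B\<^esub> (x \<otimes>\<^bsub>B\<^esub> y)"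
    "x \<otimes>\<^bsub>B\<^esub> (c \<odot>\<^bsub>B\<^esub> y) = c \<odot>\<^bsub>B\<^esub> (x \<otimes>\<^bsub>B\<^esub> y)"
    by (auto simp: carrier_B E_smult E_mult A.smult_carrier A(5)
        A.smult_mult_left A.smult_mult_right)
qed

text \<open>On the carrier \<psi> is the composition of \<open>D\<close>, \<phi> and
  \<open>E\<close>. Outside it the value is fixed by extensionality, which \<open>lc_auto\<close>
  demands.\<close>

lemma lc_auto_conjugate:
  assumes \<phi>: "\<phi> \<in> lc_auto A" and \<psi>: "\<psi> \<in> extensional (carrier B)"
    and conj: "\<And>x. x \<in> carrier A \<Longrightarrow> \<psi> (E x) = E (\<phi> x)"
  shows "\<psi> \<in> lc_auto B"
proof -
  have \<phi>_iso: "\<phi> \<in> ring_iso A A"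
    and \<phi>_smult: "\<And>c x. x \<in> carrier A \<Longrightarrow> \<phi> (c \<odot>\<^bsub>A\<^esub> x) = c \<odot>\<^bsub>A\<^esub> \<phi> x"
    and \<phi>_homeo: "homeomorphic_map (topol A) (topol A) \<phi>"
    using \<phi> by (auto simp: lc_auto_def)
  have \<phi>_carrier: "\<phi> x \<in> carrier A" if "x \<in> carrier A" for x
    using \<phi>_iso that by (auto simp: ring_iso_def ring_hom_def)
  have homeo_\<psi>: "homeomorphic_map (topol B) (topol B) \<psi>"
  proof (rule homeomorphic_map_eq)
    have "homeomorphic_map (topol B) (topol A) D"
      using homeo homeomorphic_maps_sym homeomorphic_maps_imp_map by blast
    then show "homeomorphic_map (topol B) (topol B) (E \<circ> (\<phi> \<circ> D))"
      using \<phi>_homeo homeomorphic_maps_imp_map[OF homeo] by (intro homeomorphic_map_compose)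
  qed (auto simp: topspace_B carrier_B DE conj)
  have "bij_betw \<psi> (carrier B) (carrier B)"
    using homeomorphic_imp_injective_map[OF homeo_\<psi>] homeomorphic_imp_surjective_map[OF homeo_\<psi>]
    by (simp add: bij_betw_def topspace_B)
  moreover have "\<psi> \<in> ring_hom B B"
  proof -
    note A = ring.ring_simprules[OF A.ring_A]
    have \<phi>_hom: "\<phi> \<in> ring_hom A A" using \<phi>_iso by (simp add: ring_iso_def)
    have "\<psi> (x \<otimes>\<^bsub>B\<^esub> y) = \<psi> x \<otimes>\<^bsub>B\<^esub> \<psi> y" "\<psi> (x \<oplus>\<^bsub>B\<^esub> y) = \<psi> x \<oplus>\<^bsub>B\<^esub> \<psi> y"
      if "x \<in> carrier B" "y \<in> carrier B" for x y
      using that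
      by (auto simp: carrier_B E_mult E_add conj \<phi>_carrier A(1,5) ring_hom_mult[OF \<phi>_hom]
          ring_hom_add[OF \<phi>_hom])
    moreover have "\<psi> \<one>\<^bsub>B\<^esub> = \<one>\<^bsub>B\<^esub>"
      by (simp add: E_one conj A(6) ring_hom_one[OF \<phi>_hom])
    moreover have "\<psi> x \<in> carrier B" if "x \<in> carrier B" for x
      using that by (auto simp: carrier_B conj \<phi>_carrier)
    ultimately show ?thesis by (intro ring_hom_memI)
  qed
  ultimately show ?thesis
    using \<psi> homeo_\<psi> \<phi>_smult \<phi>_carrier
    by (auto simp: lc_auto_def ring_iso_def carrier_B conj E_smult A.smult_carrier)
qed

lemma dynamical_system_conjugate:
  assumes dyn: "dynamical_system A G TG \<alpha>"
    and ext: "\<And>g. g \<in> carrier G \<Longrightarrow> \<beta> g \<in> extensional (carrier B)"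
    and conj: "\<And>g x. \<lbrakk>g \<in> carrier G; x \<in> carrier A\<rbrakk> \<Longrightarrow> \<beta> g (E x) = E (\<alpha> g x)"
  shows "dynamical_system B G TG \<beta>"
proof -
  have G: "top_group G TG" and hom: "\<alpha> \<in> hom G (lc_Aut A)"
    and cont: "continuous_map (prod_topology TG (topol A)) (topol A) (\<lambda>(g, a). \<alpha> g a)"
    using dyn by (auto simp: dynamical_system_def)
  interpret G: top_group G TG by fact
  have \<alpha>: "\<alpha> g \<in> lc_auto A" if "g \<in> carrier G" for g
    using hom that by (auto simp: hom_def lc_Aut_def)
  have \<alpha>_carrier: "\<alpha> g x \<in> carrier A" if "g \<in> carrier G" "x \<in> carrier A" for g x
    using \<alpha>[OF that(1)] that(2) by (auto simp: lc_auto_def ring_iso_def ring_hom_def)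
  have \<alpha>_mult: "\<alpha> (g \<otimes>\<^bsub>G\<^esub> h) x = \<alpha> g (\<alpha> h x)"
    if "g \<in> carrier G" "h \<in> carrier G" "x \<in> carrier A" for g h x
    using hom_mult[OF hom that(1,2)] that(3) lc_auto_Bij[OF \<alpha>[OF that(1)]] lc_auto_Bij[OF \<alpha>[OF that(2)]]
    by (simp add: lc_Aut_def BijGroup_def compose_def)
  have \<beta>: "\<beta> g \<in> lc_auto B" if "g \<in> carrier G" for g
    using lc_auto_conjugate[OF \<alpha>[OF that] ext[OF that] conj[OF that]] .
  have "\<beta> \<in> hom G (lc_Aut B)"
  proof (rule homI)
    show "\<beta> g \<in> carrier (lc_Aut B)" if "g \<in> carrier G" for g
      using \<beta>[OF that] by (simp add: lc_Aut_def)
    fix g h assume gh: "g \<in> carrier G" "h \<in> carrier G"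
    \<comment> \<open>An equality of functions is required. Both sides are extensional, so it can be
      checked on elements of the form \<open>E x\<close>, where it is the homomorphism law for
      \<alpha>.\<close>
    have "\<beta> (g \<otimes>\<^bsub>G\<^esub> h) = compose (carrier B) (\<beta> g) (\<beta> h)"
    proof (rule extensionalityI)
      show "\<beta> (g \<otimes>\<^bsub>G\<^esub> h) \<in> extensional (carrier B)" using gh by (simp add: ext)
      show "\<beta> (g \<otimes>\<^bsub>G\<^esub> h) y = compose (carrier B) (\<beta> g) (\<beta> h) y" if "y \<in> carrier B" for y
        using that gh by (auto simp: carrier_B compose_def conj \<alpha>_mult \<alpha>_carrier)
    qed (rule compose_extensional)
    then show "\<beta> (g \<otimes>\<^bsub>G\<^esub> h) = \<beta> g \<otimes>\<^bsub>lc_Aut B\<^esub> \<beta> h"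
      using lc_auto_Bij[OF \<beta>[OF gh(1)]] lc_auto_Bij[OF \<beta>[OF gh(2)]]
      by (simp add: lc_Aut_def BijGroup_def)
  qed
  moreover have "continuous_map (prod_topology TG (topol B)) (topol B) (\<lambda>(g, b). \<beta> g b)"
  proof (rule continuous_map_eq)
    have "continuous_map (prod_topology TG (topol B)) (prod_topology TG (topol A)) (\<lambda>(g, b). (g, D b))"
      using continuous_D by (simp add: continuous_map_prod_top)
    then show "continuous_map (prod_topology TG (topol B)) (topol B)
        (E \<circ> ((\<lambda>(g, a). \<alpha> g a) \<circ> (\<lambda>(g, b). (g, D b))))"
      by (intro continuous_map_compose[OF _ continuous_E] continuous_map_compose[OF _ cont])
  qed (auto simp: topspace_B carrier_B DE conj G.topspace_group)
  ultimately show ?thesis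
    using lc_algebra_B G by (simp add: dynamical_system_def)
qed

lemma isotypic_component_conjugate:
  assumes "\<And>g x. \<lbrakk>g \<in> carrier (torus n); x \<in> carrier A\<rbrakk> \<Longrightarrow> \<beta> g (E x) = E (\<alpha> g x)"
    and "x \<in> isotypic_component n A \<alpha> k"
  shows "E x \<in> isotypic_component n B \<beta> k"
  using assms by (auto simp: isotypic_component_def carrier_B E_smult)

lemma Units_image:
  assumes "x \<in> Units A"
  shows "E x \<in> Units B"
proof -
  obtain y where "x \<in> carrier A" "y \<in> carrier A"
    "y \<otimes>\<^bsub>A\<^esub> x = \<one>\<^bsub>A\<^esub>" "x \<otimes>\<^bsub>A\<^esub> y = \<one>\<^bsub>A\<^esub>"
    using assms by (auto simp: Units_def)
  then show ?thesis by (auto simp: Units_def carrier_B E_mult E_one intro!: bexI[of _ y])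
qed

lemma trivial_nc_principal_bundle_conjugate:
  assumes triv: "trivial_nc_principal_bundle n A \<alpha>"
    and ext: "\<And>g. g \<in> carrier (torus n) \<Longrightarrow> \<beta> g \<in> extensional (carrier B)"
    and conj: "\<And>g x. \<lbrakk>g \<in> carrier (torus n); x \<in> carrier A\<rbrakk> \<Longrightarrow> \<beta> g (E x) = E (\<alpha> g x)"
  shows "trivial_nc_principal_bundle n B \<beta>"
  unfolding trivial_nc_principal_bundle_def
proof (intro conjI allI)
  show "dynamical_system B (torus n) (torus_topology n) \<beta>"
    using triv by (intro dynamical_system_conjugate[OF _ ext conj]) (simp_all add: trivial_nc_principal_bundle_def)
  fix k
  obtain x where "x \<in> isotypic_component n A \<alpha> k" "x \<in> Units A"
    using triv unfolding trivial_nc_principal_bundle_def by blast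
  then show "isotypic_component n B \<beta> k \<inter> Units B \<noteq> {}"
    using isotypic_component_conjugate[where \<alpha> = \<alpha> and \<beta> = \<beta> and n = n, OF conj] Units_image by blast
qed

end

section \<open>Conclusion: the unit as localizing element\<close>

lemma (in lc_algebra) lc_algebra_iso_localization_one:
  obtains D where "lc_algebra_iso A (localization A \<one>) fibre D"
proof -
  obtain D where "homeomorphic_maps (topol A) (topol (localization A \<one>)) fibre D"
    using homeomorphic_map_fibre homeomorphic_map_maps by blast
  then have "lc_algebra_iso A (localization A \<one>) fibre D"
    by (intro lc_algebra_iso.intro lc_algebra_iso_axioms.intro lc_algebra_axioms
        carrier_localization_one add_localization_one mult_localization_one
        smult_localization_one one_localization_one zero_localization_one)
  then show thesis by (rule that)
qed

theorem theorem8p12: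
  fixes A :: "'a top_algebra"
    and \<alpha> :: "(nat \<Rightarrow> complex) \<Rightarrow> 'a \<Rightarrow> 'a"
    and n :: nat
  assumes "trivial_nc_principal_bundle n A \<alpha>"
  shows "nc_principal_bundle n A \<alpha>"
proof -
  have dyn: "dynamical_system A (torus n) (torus_topology n) \<alpha>"
    using assms by (simp add: trivial_nc_principal_bundle_def)
  then interpret lc_algebra A by (simp add: dynamical_system_def)
  note A = ring.ring_simprules[OF ring_A]
  let ?Z = "fixed_center A (torus n) \<alpha>"
  have \<alpha>: "\<alpha> g \<in> lc_auto A" if "g \<in> carrier (torus n)" for g
    using dyn that by (auto simp: dynamical_system_def hom_def lc_Aut_def)
  then have "\<alpha> g \<one>\<^bsub>A\<^esub> = \<one>\<^bsub>A\<^esub>" if "g \<in> carrier (torus n)" for g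
    using that by (auto simp: lc_auto_def ring_iso_def ring_hom_one)
  then have one: "\<one>\<^bsub>A\<^esub> \<in> carrier ?Z"
    by (simp add: fixed_center_def Let_def A(6,12) monoid.r_one[OF ring.is_monoid[OF ring_A]])
  \<comment> \<open>Characters are only required to be nonzero somewhere; if \<xi> vanished at the
    unit, multiplicativity would make it vanish everywhere.\<close>
  have "\<xi> \<one>\<^bsub>A\<^esub> \<noteq> 0" if \<xi>: "\<xi> \<in> characters ?Z" for \<xi>
  proof
    assume "\<xi> \<one>\<^bsub>A\<^esub> = 0"
    moreover obtain x where x: "x \<in> carrier ?Z" "\<xi> x \<noteq> 0"
      using \<xi> unfolding characters_def by blast
    moreover have "\<xi> (\<one>\<^bsub>A\<^esub> \<otimes>\<^bsub>?Z\<^esub> x) = \<xi> \<one>\<^bsub>A\<^esub> * \<xi> x"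
      using \<xi> one x(1) by (simp add: characters_def)
    moreover have "\<one>\<^bsub>A\<^esub> \<otimes>\<^bsub>?Z\<^esub> x = x"
      using x(1) by (simp add: fixed_center_def Let_def A(12))
    ultimately show False by simp
  qed
  \<comment> \<open>This claim does not mention \<xi>: one localization serves all
    characters.\<close>
  moreover have "trivial_nc_principal_bundle n (localization A \<one>\<^bsub>A\<^esub>) (loc_action A \<alpha> \<one>\<^bsub>A\<^esub>)"
  proof -
    obtain D where "lc_algebra_iso A (localization A \<one>\<^bsub>A\<^esub>) fibre D"
      by (rule lc_algebra_iso_localization_one)
    then show ?thesis
      using assms
    proof (rule lc_algebra_iso.trivial_nc_principal_bundle_conjugate)
      show "loc_action A \<alpha> \<one>\<^bsub>A\<^esub> g \<in> extensional (carrier (localization A \<one>\<^bsub>A\<^esub>))" for g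
        by (simp add: loc_action_def)
      show "loc_action A \<alpha> \<one>\<^bsub>A\<^esub> g (fibre x) = fibre (\<alpha> g x)"
        if "g \<in> carrier (torus n)" "x \<in> carrier A" for g x
        using \<alpha>[OF that(1)] that(2) by (rule loc_action_one[where \<alpha> = \<alpha>])
    qed
  qed
  ultimately show ?thesis
    using dyn one unfolding nc_principal_bundle_def by blast
qed

end
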